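(* Let $P$ be any distribution on $\mathbb{R}^d\times\mathbb{R}$ with a density, such that the marginal distribution of $X$ is $P_X=\mathcal{N}(0,\Sigma)$ for some positive definite $\Sigma\in\mathbb{R}^{d\times d}$, and let $n\geq1$. Then, if $d\geq n+2$, $$\lambda_{n,d}(P)\leq\frac12\sqrt{\frac{n}{d-n-1}}.$$
   Context: A density means a density with respect to Lebesgue measure, and $(X,Y)\sim P$ with $X\in\mathbb{R}^d$, $Y\in\mathbb{R}$. Let $\mathcal{Q}_{\mathrm{lin}}$ be the set of distributions $Q$ on $\mathbb{R}^d\times\mathbb{R}$ such that for some $\beta\in\mathbb{R}^d$, $Y=X^\top\beta$ holds $Q$-almost surely; let $\mathcal{Q}_{\mathrm{lin}}^{(n)}=\{Q^n:Q\in\mathcal{Q}_{\mathrm{lin}}\}$; and let $\tilde{\mathcal{Q}}_{\mathrm{lin}}^{(n)}$ be the family of mixtures of distributions in $\mathcal{Q}_{\mathrm{lin}}^{(n)}$, i.e. distributions obtained by drawing $P_0\sim\nu$ for some probability measure $\nu$ on $\mathcal{Q}_{\mathrm{lin}}$ and then sampling from $(P_0)^n$. For a distribution $P$ on $\mathbb{R}^d\times\mathbb{R}$ define $\lambda_{n,d}(P)=\inf_{Q\in\tilde{\mathcal{Q}}_{\mathrm{lin}}^{(n)}}\mathrm{d}_{\mathrm{TV}}(P^n,Q)$, where $\mathrm{d}_{\mathrm{TV}}(\mu,\nu)=\sup_A|\mu(A)-\nu(A)|$ is total variation distance. *)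

theory Defs
  imports "HOL-Probability.Probability"
begin

definition positive_definite :: "real^'n^'n \<Rightarrow> bool" where
  "positive_definite S \<longleftrightarrow> transpose S = S \<and> (\<forall>x. x \<noteq> 0 \<longrightarrow> 0 < x \<bullet> (S *v x))"

text \<open>The formula below is a probability density only if \<open>S\<close> is positive definite.\<close>

definition multivariate_normal :: "real^'n \<Rightarrow> real^'n^'n \<Rightarrow> (real^'n) measure" where
  "multivariate_normal m S = density lborel
     (\<lambda>x. ennreal (exp (- ((x - m) \<bullet> (matrix_inv S *v (x - m))) / 2)
                   / sqrt ((2 * pi) ^ CARD('n) * det S)))"

text \<open>For measures \<open>M\<close> and \<open>N\<close> with the same measurable sets.\<close>

definition tv_dist :: "'a measure \<Rightarrow> 'a measure \<Rightarrow> real" where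
  "tv_dist M N = (SUP A\<in>sets M. \<bar>measure M A - measure N A\<bar>)"

definition iid_power :: "nat \<Rightarrow> 'a measure \<Rightarrow> (nat \<Rightarrow> 'a) measure" where
  "iid_power n P = PiM {..<n} (\<lambda>_. P)"

definition Q_lin :: "((real^'d) \<times> real) measure set" where
  "Q_lin = {Q. sets Q = sets borel \<and> prob_space Q \<and>
               (\<exists>\<beta>. AE (x, y) in Q. y = x \<bullet> \<beta>)}"

text \<open>
  A probability measure on \<^const>\<open>Q_lin\<close> is one for the smallest sigma-algebra that makes all the
  evaluations \<open>Q \<mapsto> Q(A)\<close>, for \<open>A\<close> Borel, measurable. This is the trace on \<^const>\<open>Q_lin\<close> of the
  sigma-algebra of \<^const>\<open>prob_algebra\<close>.
\<close>

definition mixtures_lin :: "nat \<Rightarrow> (nat \<Rightarrow> (real^'d) \<times> real) measure set" where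
  "mixtures_lin n =
     (\<lambda>\<nu>. \<nu> \<bind> iid_power n) ` space (prob_algebra (restrict_space (prob_algebra borel) Q_lin))"

definition lambda_lin :: "nat \<Rightarrow> ((real^'d) \<times> real) measure \<Rightarrow> real" where
  "lambda_lin n P = (INF Q\<in>mixtures_lin n. tv_dist (iid_power n P) Q)"


lemma measurable_iid_power:
  "iid_power n \<in> prob_algebra M \<rightarrow>\<^sub>M prob_algebra (PiM {..<n} (\<lambda>_. M))"
proof -
  let ?G = "{Pi\<^sub>E {..<n} X |X. X \<in> {..<n} \<rightarrow> sets M}"
  let ?\<Omega> = "Pi\<^sub>E {..<n} (\<lambda>_. space M)"
  have eq: "sets (PiM {..<n} (\<lambda>_. M)) = sigma_sets ?\<Omega> ?G"
    by (simp add: sets_PiM prod_algebra_eq_finite)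
  show ?thesis
  proof (rule measurable_prob_algebra_generated[OF eq])
    show "Int_stable ?G"
    proof (rule Int_stableI)
      fix a b assume "a \<in> ?G" "b \<in> ?G"
      then obtain X Y where "a = Pi\<^sub>E {..<n} X" "b = Pi\<^sub>E {..<n} Y"
        "X \<in> {..<n} \<rightarrow> sets M" "Y \<in> {..<n} \<rightarrow> sets M" by auto
      then show "a \<inter> b \<in> ?G"
        by (auto simp: PiE_Int intro!: exI[of _ "\<lambda>i. X i \<inter> Y i"])
    qed
    show "?G \<subseteq> Pow ?\<Omega>"
      by (force simp: PiE_def Pi_def dest: sets.sets_into_space)
  next
    fix P assume "P \<in> space (prob_algebra M)"
    then have P: "prob_space P" "sets P = sets M" by (auto simp: space_prob_algebra)
    show "prob_space (iid_power n P)"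
      unfolding iid_power_def by (intro prob_space_PiM P)
    show "sets (iid_power n P) = sets (PiM {..<n} (\<lambda>_. M))"
      unfolding iid_power_def by (intro sets_PiM_cong P refl)
  next
    fix A assume "A \<in> ?G"
    then obtain X where A: "A = Pi\<^sub>E {..<n} X" and X: "\<And>i. i < n \<Longrightarrow> X i \<in> sets M" by auto
    have "emeasure (iid_power n P) A = (\<Prod>i<n. emeasure P (X i))"
      if "P \<in> space (prob_algebra M)" for P
    proof -
      from that have P: "prob_space P" "sets P = sets M" by (auto simp: space_prob_algebra)
      interpret prob_space P by (rule P)
      interpret product_sigma_finite "\<lambda>_::nat. P" ..
      show ?thesis unfolding iid_power_def A using P X by (intro emeasure_PiM) auto
    qed
    moreover have "(\<lambda>P. \<Prod>i<n. emeasure P (X i)) \<in> borel_measurable (prob_algebra M)"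
      using X by (intro borel_measurable_prod_ennreal)
        (auto simp: prob_algebra_def intro!: measurable_restrict_space1)
    ultimately show "(\<lambda>P. emeasure (iid_power n P) A) \<in> borel_measurable (prob_algebra M)"
      by (subst measurable_cong) auto
  qed
qed

lemma emeasure_mixture:
  assumes "\<nu> \<in> space (prob_algebra (restrict_space (prob_algebra M) S))"
    and "A \<in> sets (PiM {..<n} (\<lambda>_. M))"
  shows "emeasure (\<nu> \<bind> iid_power n) A = (\<integral>\<^sup>+ P. emeasure (iid_power n P) A \<partial>\<nu>)"
  by (rule emeasure_bind_prob_algebra[OF assms(1) measurable_restrict_space1[OF measurable_iid_power] assms(2)])

end

theory Submission
  imports Defs
begin

text \<open>
  Write \<open>d\<close> for the dimension and \<open>B x y = x \<bullet> (\<Sigma>\<^sup>-\<^sup>1 y)\<close>, let \<open>\<gamma>\<close> be the law of \<open>X\<close> and \<open>p\<close> the density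
  of \<open>P\<close>, and fix a scale \<open>R > 0\<close>. Every \<open>b\<close> gives the regression function \<open>x \<mapsto> R B x b\<close>, which is
  linear in \<open>x\<close>. Take for \<open>Q\<^sub>b\<close> the distribution carried by its graph whose design has density
  proportional to \<open>p (x, R B x b)\<close>, with normalising integral \<open>c b\<close>, and draw \<open>b\<close> from \<open>\<gamma>\<close> reweighted
  proportionally to \<open>(c b)\<^sup>n\<close>. The weight cancels the normalisation of the \<open>n\<close> samples, so that up to
  one constant the mixture integrates a function \<open>f\<close> of the sample to the integral of
  \<open>f (x, y) (\<Prod>i. p (x\<^sub>i, y\<^sub>i))\<close> over \<open>b \<sim> \<gamma>\<close> and over \<open>x\<close>, with \<open>y\<^sub>i = R B x\<^sub>i b\<close>. For fixed linearly
  independent \<open>x\<close> the vector \<open>y\<close> is Gaussian under \<open>b \<sim> \<gamma>\<close>. Hence the mixture has a density with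
  respect to \<open>P\<^sup>n\<close>, and this density is a multiple of the Gaussian density of \<open>y\<close> given \<open>x\<close>
  (\<open>linear_model_density\<close>, \<open>density_ratio_in_mixtures\<close>): the unknown \<open>p\<close> has disappeared from it.

  Let \<open>u\<^sub>j\<close>, \<open>0 \<le> j < n\<close>, be the Gram--Schmidt vectors of \<open>x\<close> for \<open>B\<close>. After removal of the factor
  \<open>(sqrt (2 \<pi>) R)\<^sup>-\<^sup>n\<close>, the Gaussian density is at most \<open>D = (\<Prod>j<n. 1 / sqrt (B u\<^sub>j u\<^sub>j))\<close>, the
  reciprocal of the volume spanned by the design, and it converges to \<open>D\<close> as \<open>R \<longlongrightarrow> \<infinity>\<close>. Total
  variation is at most half the root of the chi-square divergence (\<open>tv_dist_density_le\<close>), so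
  \<open>\<lambda>\<^sub>n\<^sub>,\<^sub>d(P)\<close> is at most \<open>1/2 sqrt (E D\<^sup>2 / (E D)\<^sup>2 - 1)\<close>.

  Only the design enters \<open>D\<close>. Given the earlier rows, \<open>B u\<^sub>j u\<^sub>j\<close> has the chi-square law with
  \<open>k = d - j\<close> degrees of freedom (\<open>laplace_residual\<close>). For such a variable \<open>q\<close> one has
  \<open>E (1/q) \<le> 1 / (k - 2)\<close> and \<open>E (1 / sqrt q) \<ge> 1 / sqrt (k - 1)\<close>, whence
  \<open>E D\<^sup>2 / (E D)\<^sup>2 \<le> (\<Prod>j<n. (d - j - 1) / (d - j - 2)) = (d - 1) / (d - n - 1) = 1 + n / (d - n - 1)\<close>,
  which is the claim.
\<close>

section \<open>Reciprocal moments from Laplace transforms\<close>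

text \<open>Compare the two power series term by term, using \<open>2\<^sup>n n! \<le> (2n)!\<close>.\<close>
lemma cosh_le_exp_half_square: "cosh (x::real) \<le> exp (x\<^sup>2 / 2)"
proof -
  have fact_le: "2 ^ n * fact n \<le> (fact (2 * n) :: real)" for n
  proof (induction n)
    case (Suc n)
    have "2 ^ Suc n * fact (Suc n) = (2 * (real n + 1)) * (2 ^ n * fact n :: real)"
      by (simp add: algebra_simps)
    also have "\<dots> \<le> ((2 * real n + 2) * (2 * real n + 1)) * fact (2 * n)"
      using Suc by (intro mult_mono) (auto simp: algebra_simps)
    also have "\<dots> = fact (2 * Suc n)"
      by (simp add: algebra_simps)
    finally show ?case .
  qed simp
  have even: "(\<lambda>n. x ^ (2 * n) / fact (2 * n)) sums cosh x"
  proof -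
    have "strict_mono (\<lambda>n::nat. 2 * n)" by (simp add: strict_mono_def)
    have "(\<lambda>n. if even (2 * n) then x ^ (2 * n) /\<^sub>R fact (2 * n) else 0) sums cosh x"
      using cosh_converges[of x]
      by (subst sums_mono_reindex[OF \<open>strict_mono _\<close>, of "\<lambda>n. if even n then x ^ n /\<^sub>R fact n else 0"])
        (auto elim!: evenE)
    then show ?thesis by (simp add: divide_inverse mult.commute)
  qed
  have exp: "(\<lambda>n. (x\<^sup>2 / 2) ^ n / fact n) sums exp (x\<^sup>2 / 2)"
    using exp_converges[of "x\<^sup>2 / 2"] by (simp only: divide_real_def real_scaleR_def mult.commute[of "inverse a" for a])
  have "x ^ (2 * n) / fact (2 * n) \<le> (x\<^sup>2 / 2) ^ n / fact n" for n
    using divide_left_mono[OF fact_le[of n], of "x ^ (2 * n)"] by (simp add: power_divide power_mult)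
  from sums_le[OF this even exp] show ?thesis .
qed

lemma nn_integral_exp_square:
  assumes "0 < (q::real)"
  shows "(\<integral>\<^sup>+ s. ennreal (exp (- (s\<^sup>2 * q / 2))) \<partial>lborel) = ennreal (sqrt (2 * pi) / sqrt q)"
proof -
  let ?\<sigma> = "1 / sqrt q"
  have "exp (- (s\<^sup>2 * q / 2)) = sqrt (2 * pi) / sqrt q * normal_density 0 ?\<sigma> s" for s
    using assms by (simp add: normal_density_def power_divide real_sqrt_divide)
  then have "(\<integral>\<^sup>+ s. ennreal (exp (- (s\<^sup>2 * q / 2))) \<partial>lborel)
      = ennreal (sqrt (2 * pi) / sqrt q) * (\<integral>\<^sup>+ s. ennreal (normal_density 0 ?\<sigma> s) \<partial>lborel)"
    using assms by (simp add: ennreal_mult' nn_integral_cmult del: times_divide_eq_left)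
  also have "(\<integral>\<^sup>+ s. ennreal (normal_density 0 ?\<sigma> s) \<partial>lborel) = 1"
    using prob_space.emeasure_space_1[OF prob_space_normal_density[of ?\<sigma> 0]] assms
    by (simp add: emeasure_density)
  finally show ?thesis by simp
qed

text \<open>
  The substitution \<open>s = sinh v\<close> turns the integrand into \<open>(1 / cosh v) ^ (k - 1)\<close>, which dominates a
  Gaussian because \<open>cosh v \<le> exp (v\<^sup>2 / 2)\<close>. The loss of one in the exponent is what makes the bound
  \<open>k - 1\<close>; the cruder \<open>1 + s\<^sup>2 \<le> exp (s\<^sup>2)\<close> would only give \<open>k\<close>, and then the product over the
  observations would not telescope to the required constant.
\<close>
lemma nn_integral_student_ge:
  assumes "2 \<le> k"
  shows "ennreal (sqrt (2 * pi) / sqrt (real k - 1))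
    \<le> (\<integral>\<^sup>+ s. ennreal ((1 / sqrt (1 + s\<^sup>2)) ^ k) \<partial>lborel)" (is "_ \<le> ?J")
proof -
  define g where "g s = ennreal (exp (- (s\<^sup>2 * (real k - 1) / 2)))" for s :: real
  have pow: "(1 / sqrt (1 + (sinh v)\<^sup>2)) ^ k * cosh v = (1 / cosh v) ^ (k - 1)" for v :: real
  proof -
    have "sqrt (1 + (sinh v)\<^sup>2) = cosh v"
      using cosh_square_eq[of v] by (simp add: add.commute real_sqrt_unique)
    moreover have "(1 / cosh v) ^ k = (1 / cosh v) * (1 / cosh v) ^ (k - 1)"
      using assms by (cases k) auto
    ultimately show ?thesis by simp
  qed
  have bound: "exp (- (v\<^sup>2 * (real k - 1) / 2)) \<le> (1 / cosh v) ^ (k - 1)" for v :: real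
  proof -
    have "exp (- (v\<^sup>2 * (real k - 1) / 2)) = exp (- (v\<^sup>2 / 2)) ^ (k - 1)"
      using assms by (simp add: exp_of_nat_mult[symmetric] of_nat_diff algebra_simps diff_divide_distrib)
    also have "\<dots> \<le> (1 / cosh v) ^ (k - 1)"
      using cosh_le_exp_half_square[of v]
      by (intro power_mono) (auto simp: exp_minus inverse_eq_divide intro!: divide_left_mono)
    finally show ?thesis .
  qed
  have le: "(\<integral>\<^sup>+ s. g s * indicator {- real N..real N} s \<partial>lborel) \<le> ?J" for N
  proof -
    have "(\<integral>\<^sup>+ s. g s * indicator {- real N..real N} s \<partial>lborel)
        \<le> (\<integral>\<^sup>+ v. ennreal ((1 / sqrt (1 + (sinh v)\<^sup>2)) ^ k * cosh v * indicator {- real N..real N} v) \<partial>lborel)"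
      unfolding pow g_def using bound by (intro nn_integral_mono) (auto split: split_indicator intro!: ennreal_leI)
    also have "\<dots> = (\<integral>\<^sup>+ s. ennreal ((1 / sqrt (1 + s\<^sup>2)) ^ k * indicator {sinh (- real N)..sinh (real N)} s) \<partial>lborel)"
      by (rule nn_integral_substitution[symmetric])
        (auto intro!: derivative_eq_intros continuous_intros simp: set_borel_measurable_def)
    also have "\<dots> \<le> ?J"
      by (intro nn_integral_mono) (auto split: split_indicator)
    finally show ?thesis .
  qed
  have "(\<lambda>N. \<integral>\<^sup>+ s. g s * indicator {- real N..real N} s \<partial>lborel) \<longlonglongrightarrow> (\<integral>\<^sup>+ s. g s \<partial>lborel)"
  proof (rule nn_integral_LIMSEQ)
    show "incseq (\<lambda>N s. g s * indicator {- real N..real N} s)"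
      by (auto simp: incseq_def le_fun_def split: split_indicator)
    show "(\<lambda>N. g s * indicator {- real N..real N} s) \<longlonglongrightarrow> g s" for s
    proof -
      obtain N0 :: nat where "\<bar>s\<bar> \<le> real N0" using real_arch_simple by blast
      then have "eventually (\<lambda>N. g s * indicator {- real N..real N} s = g s) sequentially"
        by (intro eventually_sequentiallyI[of N0]) (auto split: split_indicator)
      then show ?thesis by (rule tendsto_eventually)
    qed
  qed (auto simp: g_def)
  from LIMSEQ_le_const2[OF this] le have "(\<integral>\<^sup>+ s. g s \<partial>lborel) \<le> ?J" by auto
  then show ?thesis using nn_integral_exp_square[of "real k - 1"] assms by (simp add: g_def)
qed

text \<open>
  The hypothesis on the Laplace transform says that \<open>q\<close> has the chi-square law with \<open>k\<close> degrees of
  freedom. Integrate \<open>1 / q = (\<integral>t\<ge>0. 1/2 exp (- t q / 2))\<close> against \<open>M\<close> and exchange the integrals.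
  The convention \<open>1 / 0 = 0\<close> leaves an inequality where \<open>q\<close> vanishes, in the direction needed.
\<close>
lemma nn_integral_inverse_from_laplace:
  assumes "sigma_finite_measure M" and [measurable]: "q \<in> borel_measurable M"
    and q0: "\<And>x. 0 \<le> q x"
    and laplace: "\<And>t. 0 \<le> t \<Longrightarrow> (\<integral>\<^sup>+ x. ennreal (exp (- t * q x / 2)) \<partial>M) = ennreal ((1 / sqrt (1 + t)) ^ k)"
    and k: "3 \<le> k"
  shows "(\<integral>\<^sup>+ x. ennreal (1 / q x) \<partial>M) \<le> ennreal (1 / (real k - 2))"
proof -
  interpret sigma_finite_measure M by fact
  interpret P: pair_sigma_finite M "lborel :: real measure" ..
  let ?f = "\<lambda>x t. ennreal (1 / 2 * exp (- t * q x / 2)) * indicator {0..} t"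
  have *: "ennreal (1 / q x) \<le> (\<integral>\<^sup>+ t. ?f x t \<partial>lborel)" for x
  proof (cases "q x = 0")
    case False
    then have q: "0 < q x" using q0[of x] by simp
    have "(\<integral>\<^sup>+ t. ?f x t \<partial>lborel) = ennreal (0 - - (exp (- 0 * q x / 2) / q x))"
    proof (rule nn_integral_FTC_atLeast)
      show "((\<lambda>t. - (exp (- t * q x / 2) / q x)) has_real_derivative 1 / 2 * exp (- t * q x / 2)) (at t)" for t
        using q by (auto intro!: derivative_eq_intros simp: field_simps)
      have "((\<lambda>t. - (exp (- t * q x / 2) / q x)) \<longlongrightarrow> - (0 / q x)) at_top"
      proof (intro tendsto_intros)
        show "((\<lambda>t. exp (- t * q x / 2)) \<longlongrightarrow> 0) at_top"
          using q
          using filterlim_tendsto_neg_mult_at_bot[OF tendsto_const _ filterlim_ident, of "- (q x / 2)"]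
          by (intro filterlim_compose[OF exp_at_bot]) (simp add: mult.commute)
      qed (use q in auto)
      then show "((\<lambda>t. - (exp (- t * q x / 2) / q x)) \<longlongrightarrow> 0) at_top" by simp
    qed auto
    then show ?thesis by simp
  qed simp
  have "(\<integral>\<^sup>+ x. ennreal (1 / q x) \<partial>M) \<le> (\<integral>\<^sup>+ x. \<integral>\<^sup>+ t. ?f x t \<partial>lborel \<partial>M)"
    by (intro nn_integral_mono *)
  also have "\<dots> = (\<integral>\<^sup>+ t. \<integral>\<^sup>+ x. ?f x t \<partial>M \<partial>lborel)"
    by (rule P.Fubini'[symmetric]) measurable
  also have "\<dots> = (\<integral>\<^sup>+ t. ennreal (1 / 2 * (1 + t) powr (- real k / 2)) * indicator {0..} t \<partial>lborel)"
  proof (intro nn_integral_cong)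
    fix t :: real
    show "(\<integral>\<^sup>+ x. ?f x t \<partial>M) = ennreal (1 / 2 * (1 + t) powr (- real k / 2)) * indicator {0..} t"
    proof (cases "0 \<le> t")
      case True
      have pow: "(1 / sqrt (1 + t)) ^ k = (1 + t) powr (- real k / 2)"
      proof -
        have "1 / sqrt (1 + t) = (1 + t) powr (- (1 / 2))"
          using True by (simp add: powr_minus_divide powr_half_sqrt)
        then have "(1 / sqrt (1 + t)) ^ k = ((1 + t) powr (- (1 / 2))) powr real k"
          using True by (subst powr_realpow) auto
        then show ?thesis by (simp add: powr_powr)
      qed
      have "(\<integral>\<^sup>+ x. ennreal (1 / 2 * exp (- t * q x / 2)) \<partial>M)
          = (\<integral>\<^sup>+ x. ennreal (1 / 2) * ennreal (exp (- t * q x / 2)) \<partial>M)"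
        by (intro nn_integral_cong ennreal_mult) simp_all
      also have "\<dots> = ennreal (1 / 2) * (\<integral>\<^sup>+ x. ennreal (exp (- t * q x / 2)) \<partial>M)"
        by (rule nn_integral_cmult) measurable
      also have "\<dots> = ennreal (1 / 2 * (1 + t) powr (- real k / 2))"
        unfolding laplace[OF True] pow by (rule ennreal_mult[symmetric]) simp_all
      finally show ?thesis using True by simp
    qed simp
  qed
  also have "\<dots> = ennreal (0 - - ((1 + 0) powr (1 - real k / 2) / (real k - 2)))"
  proof (rule nn_integral_FTC_atLeast)
    show "((\<lambda>t. - ((1 + t) powr (1 - real k / 2) / (real k - 2))) has_real_derivative
        1 / 2 * (1 + t) powr (- real k / 2)) (at t)" if "0 \<le> t" for t
    proof -
      have "((\<lambda>t. (1 + t) powr (1 - real k / 2)) has_real_derivative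
          (1 - real k / 2) * (1 + t) powr (1 - real k / 2 - 1) * (0 + 1)) (at t)"
        using that by (intro DERIV_chain2[OF has_real_derivative_powr] DERIV_add DERIV_const DERIV_ident) simp
      from DERIV_minus[OF DERIV_cdivide[OF this, of "real k - 2"]]
      show ?thesis by (rule back_subst[where P="\<lambda>D. (_ has_real_derivative D) _"]) (use k in \<open>simp add: field_simps\<close>)
    qed
    have "((\<lambda>t::real. (1 + t) powr (1 - real k / 2)) \<longlongrightarrow> 0) at_top"
      using k by (intro tendsto_neg_powr filterlim_tendsto_add_at_top[OF tendsto_const filterlim_ident]) auto
    from tendsto_minus[OF tendsto_divide[OF this tendsto_const[of "real k - 2"]]] k
    show "((\<lambda>t. - ((1 + t) powr (1 - real k / 2) / (real k - 2))) \<longlongrightarrow> 0) at_top" by simp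
  qed auto
  finally show ?thesis by simp
qed

text \<open>
  As before, now starting from the Gaussian integral \<open>1 / sqrt q = (\<integral>s. exp (- s\<^sup>2 q / 2)) / sqrt (2 \<pi>)\<close>.
\<close>
lemma nn_integral_inverse_sqrt_from_laplace:
  assumes "sigma_finite_measure M" and [measurable]: "q \<in> borel_measurable M"
    and q0: "AE x in M. 0 < q x"
    and laplace: "\<And>t. 0 \<le> t \<Longrightarrow> (\<integral>\<^sup>+ x. ennreal (exp (- t * q x / 2)) \<partial>M) = ennreal ((1 / sqrt (1 + t)) ^ k)"
    and k: "2 \<le> k"
  shows "ennreal (1 / sqrt (real k - 1)) \<le> (\<integral>\<^sup>+ x. ennreal (1 / sqrt (q x)) \<partial>M)"
proof -
  interpret sigma_finite_measure M by fact
  interpret P: pair_sigma_finite M "lborel :: real measure" ..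
  let ?c = "ennreal (1 / sqrt (2 * pi))"
  have "ennreal (1 / sqrt (real k - 1)) = ?c * ennreal (sqrt (2 * pi) / sqrt (real k - 1))"
    using k by (simp add: ennreal_mult[symmetric])
  also have "\<dots> \<le> ?c * (\<integral>\<^sup>+ s. ennreal ((1 / sqrt (1 + s\<^sup>2)) ^ k) \<partial>lborel)"
    by (intro mult_left_mono nn_integral_student_ge k) simp
  also have "\<dots> = ?c * (\<integral>\<^sup>+ s. \<integral>\<^sup>+ x. ennreal (exp (- (s\<^sup>2 * q x / 2))) \<partial>M \<partial>lborel)"
    using laplace by (simp add: mult.assoc)
  also have "\<dots> = ?c * (\<integral>\<^sup>+ x. \<integral>\<^sup>+ s. ennreal (exp (- (s\<^sup>2 * q x / 2))) \<partial>lborel \<partial>M)"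
    by (subst P.Fubini') simp_all
  also have "\<dots> = ?c * (\<integral>\<^sup>+ x. ennreal (sqrt (2 * pi) / sqrt (q x)) \<partial>M)"
    using q0 by (intro arg_cong2[where f="(*)"] nn_integral_cong_AE refl) (auto elim!: eventually_mono simp: nn_integral_exp_square)
  also have "\<dots> = (\<integral>\<^sup>+ x. ?c * ennreal (sqrt (2 * pi) / sqrt (q x)) \<partial>M)"
    by (simp add: nn_integral_cmult)
  also have "\<dots> = (\<integral>\<^sup>+ x. ennreal (1 / sqrt (q x)) \<partial>M)"
    using q0 by (intro nn_integral_cong_AE) (auto elim!: eventually_mono simp: ennreal_mult[symmetric])
  finally show ?thesis .
qed

section \<open>Gaussian laws given by a quadratic form\<close>

lemma nn_integral_lborel_translate:
  fixes f :: "'c::euclidean_space \<Rightarrow> ennreal"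
  assumes [measurable]: "f \<in> borel_measurable borel"
  shows "(\<integral>\<^sup>+ x. f (x + c) \<partial>lborel) = (\<integral>\<^sup>+ x. f x \<partial>lborel)"
proof -
  have "(\<integral>\<^sup>+ x. f x \<partial>lborel) = (\<integral>\<^sup>+ x. f x \<partial>distr lborel borel ((+) c))"
    by (simp add: lborel_distr_plus)
  also have "\<dots> = (\<integral>\<^sup>+ x. f (x + c) \<partial>lborel)"
    by (subst nn_integral_distr) (auto simp: add.commute)
  finally show ?thesis by simp
qed

lemma nn_integral_std_normal_density: "(\<integral>\<^sup>+ t. ennreal (std_normal_density t) \<partial>lborel) = 1"
  using prob_space.emeasure_space_1[OF prob_space_normal_density[of 1 0]]
  by (simp add: emeasure_density)

text \<open>
  The centred Gaussian law with inverse covariance \<open>B\<close>. Working with the form \<open>B\<close> in place of the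
  inner product avoids a change of variables by a square root of the covariance matrix.
\<close>
locale gaussian_form = bounded_bilinear B
  for B :: "'a::euclidean_space \<Rightarrow> 'a \<Rightarrow> real" +
  fixes \<kappa> :: real
  assumes sym: "B x y = B y x"
    and pos: "x \<noteq> 0 \<Longrightarrow> 0 < B x x"
    and \<kappa>_pos: "0 < \<kappa>"
    and normalised: "(\<integral>\<^sup>+ x. ennreal (\<kappa> * exp (- B x x / 2)) \<partial>lborel) = 1"
begin

definition \<gamma> :: "'a measure" where
  "\<gamma> = density lborel (\<lambda>x. ennreal (\<kappa> * exp (- B x x / 2)))"

lemma measurable_form [measurable (raw)]:
  assumes [measurable]: "f \<in> borel_measurable N" "g \<in> borel_measurable N"
  shows "(\<lambda>x. B (f x) (g x)) \<in> borel_measurable N"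
proof -
  have "case_prod B \<in> borel_measurable (borel \<Otimes>\<^sub>M borel)"
    unfolding borel_prod by (intro borel_measurable_continuous_onI)
      (auto simp: case_prod_beta intro!: continuous_intros continuous_on)
  then show ?thesis by measurable
qed

lemma sets_\<gamma> [measurable_cong, simp]: "sets \<gamma> = sets borel"
  by (simp add: \<gamma>_def)

lemma space_\<gamma> [simp]: "space \<gamma> = UNIV"
  by (simp add: \<gamma>_def)

lemma prob_space_\<gamma>: "prob_space \<gamma>"
  using normalised by (intro prob_spaceI) (simp add: \<gamma>_def emeasure_density)

lemma nn_integral_\<gamma>:
  assumes [measurable]: "F \<in> borel_measurable borel"
  shows "(\<integral>\<^sup>+ x. F x \<partial>\<gamma>) = (\<integral>\<^sup>+ x. ennreal (\<kappa> * exp (- B x x / 2)) * F x \<partial>lborel)"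
  by (simp add: \<gamma>_def nn_integral_density)

text \<open>
  Let \<open>s = B u x\<close>. The substitution on the right exchanges the coordinates \<open>s\<close> and \<open>t\<close> up to a sign, a
  rotation by a quarter turn in the plane of \<open>u\<close> and the extra real axis. A quarter turn is a product
  of three shears, and each shear preserves Lebesgue measure by translation invariance in one variable.
\<close>
lemma nn_integral_rotate:
  fixes H :: "'a \<Rightarrow> real \<Rightarrow> ennreal"
  assumes u: "B u u = 1"
  assumes [measurable]: "case_prod H \<in> borel_measurable (borel \<Otimes>\<^sub>M borel)"
  shows "(\<integral>\<^sup>+ x. \<integral>\<^sup>+ t. H x t \<partial>lborel \<partial>lborel)
    = (\<integral>\<^sup>+ x. \<integral>\<^sup>+ t. H (x + (t - B u x) *\<^sub>R u) (- B u x) \<partial>lborel \<partial>lborel)"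
proof -
  have swap: "(\<integral>\<^sup>+ x. \<integral>\<^sup>+ t. G x t \<partial>lborel \<partial>lborel) = (\<integral>\<^sup>+ t. \<integral>\<^sup>+ x. G x t \<partial>lborel \<partial>lborel)"
    if [measurable]: "case_prod G \<in> borel_measurable (borel \<Otimes>\<^sub>M borel)" for G :: "'a \<Rightarrow> real \<Rightarrow> ennreal"
    by (rule lborel_pair.Fubini'[symmetric]) simp
  have "(\<integral>\<^sup>+ x. \<integral>\<^sup>+ t. H x t \<partial>lborel \<partial>lborel) = (\<integral>\<^sup>+ t. \<integral>\<^sup>+ x. H x t \<partial>lborel \<partial>lborel)"
    by (rule swap) simp
  also have "\<dots> = (\<integral>\<^sup>+ t. \<integral>\<^sup>+ x. H (x + t *\<^sub>R u) t \<partial>lborel \<partial>lborel)"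
    by (intro nn_integral_cong nn_integral_lborel_translate[symmetric]) simp
  also have "\<dots> = (\<integral>\<^sup>+ x. \<integral>\<^sup>+ t. H (x + t *\<^sub>R u) t \<partial>lborel \<partial>lborel)"
    by (rule swap[symmetric]) simp
  also have "\<dots> = (\<integral>\<^sup>+ x. \<integral>\<^sup>+ t. H (x + (t + - B u x) *\<^sub>R u) (t + - B u x) \<partial>lborel \<partial>lborel)"
    by (intro nn_integral_cong nn_integral_lborel_translate[symmetric, where f="\<lambda>t. H (_ + t *\<^sub>R u) t"]) simp
  also have "\<dots> = (\<integral>\<^sup>+ t. \<integral>\<^sup>+ x. H (x + (t + - B u x) *\<^sub>R u) (t + - B u x) \<partial>lborel \<partial>lborel)"
    by (rule swap) simp
  also have "\<dots> = (\<integral>\<^sup>+ t. \<integral>\<^sup>+ x. H ((x + t *\<^sub>R u) + (t + - B u (x + t *\<^sub>R u)) *\<^sub>R u) (t + - B u (x + t *\<^sub>R u)) \<partial>lborel \<partial>lborel)"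
    by (intro nn_integral_cong
        nn_integral_lborel_translate[symmetric, where f="\<lambda>x. H (x + (_ + - B u x) *\<^sub>R u) (_ + - B u x)"]) simp
  also have "\<dots> = (\<integral>\<^sup>+ t. \<integral>\<^sup>+ x. H (x + (t - B u x) *\<^sub>R u) (- B u x) \<partial>lborel \<partial>lborel)"
    using u by (simp add: add_right scaleR_right algebra_simps)
  also have "\<dots> = (\<integral>\<^sup>+ x. \<integral>\<^sup>+ t. H (x + (t - B u x) *\<^sub>R u) (- B u x) \<partial>lborel \<partial>lborel)"
    by (rule swap[symmetric]) simp
  finally show ?thesis .
qed

text \<open>
  The component of a Gaussian vector along a unit vector \<open>u\<close> is standard normal and independent of the
  rest, so it may be replaced by a fresh standard normal \<open>t\<close>. This is the rotation above, which
  preserves the joint Gaussian weight of \<open>x\<close> and \<open>t\<close>.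
\<close>
lemma nn_integral_resample:
  fixes F :: "'a \<Rightarrow> ennreal"
  assumes u: "B u u = 1"
  assumes [measurable]: "F \<in> borel_measurable borel"
  shows "(\<integral>\<^sup>+ x. F x \<partial>\<gamma>)
    = (\<integral>\<^sup>+ x. \<integral>\<^sup>+ t. ennreal (std_normal_density t) * F (x + (t - B u x) *\<^sub>R u) \<partial>lborel \<partial>\<gamma>)"
proof -
  define g where "g x = \<kappa> * exp (- B x x / 2)" for x
  have [measurable]: "g \<in> borel_measurable borel" unfolding g_def by measurable
  have g0: "0 \<le> g x" for x using \<kappa>_pos by (simp add: g_def)
  \<comment> \<open>With \<open>s = B u x\<close> the squared length changes from \<open>B x x\<close> to \<open>B x x + t\<^sup>2 - s\<^sup>2\<close>.\<close>
  have weight: "g (x + (t - B u x) *\<^sub>R u) * std_normal_density (- B u x) = g x * std_normal_density t" for x t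
  proof -
    let ?y = "x + (t - B u x) *\<^sub>R u"
    have "B ?y ?y = B x x + t\<^sup>2 - (B u x)\<^sup>2"
      using u sym[of x u]
      by (simp add: add_left add_right diff_left diff_right scaleR_left scaleR_right algebra_simps power2_eq_square)
    then have "exp (- B ?y ?y / 2) * exp (- (- B u x)\<^sup>2 / 2) = exp (- B x x / 2) * exp (- t\<^sup>2 / 2)"
      by (simp add: exp_add[symmetric] field_simps del: exp_add)
    then show ?thesis by (simp add: g_def std_normal_density_def field_simps)
  qed
  have "(\<integral>\<^sup>+ x. F x \<partial>\<gamma>) = (\<integral>\<^sup>+ x. ennreal (g x) * F x * (\<integral>\<^sup>+ t. ennreal (std_normal_density t) \<partial>lborel) \<partial>lborel)"
    by (simp add: nn_integral_\<gamma> g_def nn_integral_std_normal_density)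
  also have "\<dots> = (\<integral>\<^sup>+ x. \<integral>\<^sup>+ t. ennreal (g x) * F x * ennreal (std_normal_density t) \<partial>lborel \<partial>lborel)"
    by (simp add: nn_integral_cmult)
  also have "\<dots> = (\<integral>\<^sup>+ x. \<integral>\<^sup>+ t. ennreal (g (x + (t - B u x) *\<^sub>R u)) * F (x + (t - B u x) *\<^sub>R u)
      * ennreal (std_normal_density (- B u x)) \<partial>lborel \<partial>lborel)"
    by (rule nn_integral_rotate[OF u]) simp
  also have "\<dots> = (\<integral>\<^sup>+ x. \<integral>\<^sup>+ t. ennreal (g x) * (ennreal (std_normal_density t) * F (x + (t - B u x) *\<^sub>R u)) \<partial>lborel \<partial>lborel)"
  proof (intro nn_integral_cong)
    fix x t
    have "ennreal (g (x + (t - B u x) *\<^sub>R u)) * ennreal (std_normal_density (- B u x))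
      = ennreal (g x) * ennreal (std_normal_density t)"
      by (subst (1 2) ennreal_mult[symmetric]) (auto simp: g0 weight)
    then show "ennreal (g (x + (t - B u x) *\<^sub>R u)) * F (x + (t - B u x) *\<^sub>R u) * ennreal (std_normal_density (- B u x))
      = ennreal (g x) * (ennreal (std_normal_density t) * F (x + (t - B u x) *\<^sub>R u))"
      by (metis mult.assoc mult.commute)
  qed
  also have "\<dots> = (\<integral>\<^sup>+ x. ennreal (g x) * \<integral>\<^sup>+ t. (ennreal (std_normal_density t) * F (x + (t - B u x) *\<^sub>R u)) \<partial>lborel \<partial>lborel)"
    by (intro nn_integral_cong nn_integral_cmult) simp
  also have "\<dots> = (\<integral>\<^sup>+ x. \<integral>\<^sup>+ t. ennreal (std_normal_density t) * F (x + (t - B u x) *\<^sub>R u) \<partial>lborel \<partial>\<gamma>)"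
    by (simp add: nn_integral_\<gamma> g_def)
  finally show ?thesis .
qed

text \<open>Rescaling by \<open>1 / sqrt (1 + t)\<close> absorbs the exponential into the Gaussian weight.\<close>
lemma laplace_form:
  assumes t: "0 \<le> t"
  shows "(\<integral>\<^sup>+ x. ennreal (exp (- t * B x x / 2)) \<partial>\<gamma>) = ennreal ((1 / sqrt (1 + t)) ^ DIM('a))"
proof -
  define c where "c = 1 / sqrt (1 + t)"
  have c: "0 < c" "c\<^sup>2 * (1 + t) = 1" using t by (auto simp: c_def power_divide)
  have "(\<integral>\<^sup>+ x. ennreal (exp (- t * B x x / 2)) \<partial>\<gamma>)
      = (\<integral>\<^sup>+ x. ennreal (\<kappa> * exp (- ((1 + t) * B x x) / 2)) \<partial>lborel)"
    by (subst nn_integral_\<gamma>)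
      (auto intro!: nn_integral_cong simp: ennreal_mult[symmetric] \<kappa>_pos less_imp_le exp_add[symmetric] field_simps)
  also have "\<dots> = (\<integral>\<^sup>+ x. ennreal (\<kappa> * exp (- ((1 + t) * B x x) / 2))
      \<partial>density (distr lborel borel (\<lambda>x. 0 + c *\<^sub>R x)) (\<lambda>_. \<bar>c\<bar>^DIM('a)))"
    using c by (subst lborel_affine[of c 0]) auto
  also have "\<dots> = (\<integral>\<^sup>+ x. ennreal (c ^ DIM('a)) * ennreal (\<kappa> * exp (- ((1 + t) * (c\<^sup>2 * B x x)) / 2)) \<partial>lborel)"
    using c by (simp add: nn_integral_density nn_integral_distr scaleR_left scaleR_right power2_eq_square mult.assoc)
  also have "\<dots> = (\<integral>\<^sup>+ x. ennreal (c ^ DIM('a)) * ennreal (\<kappa> * exp (- B x x / 2)) \<partial>lborel)"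
    using c(2) by (simp add: mult.assoc[symmetric] mult.commute[of "1 + t"])
  also have "\<dots> = ennreal (c ^ DIM('a))"
    using normalised by (simp add: nn_integral_cmult)
  finally show ?thesis by (simp add: c_def)
qed

end

lemma laplace_1d:
  fixes t :: real
  assumes t: "0 \<le> t"
  shows "(\<integral>\<^sup>+ s. ennreal (std_normal_density s) * ennreal (exp (- t * s\<^sup>2 / 2)) \<partial>lborel) = ennreal (1 / sqrt (1 + t))"
proof -
  interpret gaussian_form "(\<bullet>) :: real \<Rightarrow> real \<Rightarrow> real" "1 / sqrt (2 * pi)"
    using nn_integral_std_normal_density
    by unfold_locales (auto simp: algebra_simps std_normal_density_def power2_eq_square
       abs_mult less_le intro!: exI[of _ 1])
  show ?thesis
    using laplace_form[OF t]
    by (subst (asm) nn_integral_\<gamma>) (simp_all add: std_normal_density_def power2_eq_square mult.assoc)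
qed

section \<open>Gram--Schmidt residuals of a Gaussian sample\<close>

context gaussian_form
begin

text \<open>
  Gram--Schmidt without normalisation. A vector that depends on its predecessors yields \<open>0\<close>, and the
  convention \<open>a / 0 = 0\<close> then drops it from all later projections.
\<close>
fun gs :: "(nat \<Rightarrow> 'a) \<Rightarrow> nat \<Rightarrow> 'a" where
  "gs x m = x m - (\<Sum>j<m. (B (gs x j) (x m) / B (gs x j) (gs x j)) *\<^sub>R gs x j)"

declare gs.simps [simp del]

definition residual :: "(nat \<Rightarrow> 'a) \<Rightarrow> nat \<Rightarrow> 'a \<Rightarrow> 'a" where
  "residual u m z = z - (\<Sum>j<m. (B (u j) z / B (u j) (u j)) *\<^sub>R u j)"

definition orthogonal_up_to :: "nat \<Rightarrow> (nat \<Rightarrow> 'a) \<Rightarrow> bool" where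
  "orthogonal_up_to m u \<longleftrightarrow> (\<forall>i<m. \<forall>j<m. i \<noteq> j \<longrightarrow> B (u i) (u j) = 0)"

lemma gs_eq_residual: "gs x m = residual (gs x) m (x m)"
  by (subst gs.simps) (simp add: residual_def)

lemma gs_cong:
  assumes "\<And>i. i \<le> m \<Longrightarrow> x i = y i"
  shows "gs x m = gs y m"
  using assms
proof (induction m rule: less_induct)
  case (less m)
  then show ?case by (subst (1 2) gs.simps) (auto intro!: sum.cong)
qed

lemma form_nonneg: "0 \<le> B x x"
  using pos[of x] by (cases "x = 0") (auto simp: zero_left)

lemma form_eq_0_iff: "B x x = 0 \<longleftrightarrow> x = 0"
  using pos[of x] by (cases "x = 0") (auto simp: zero_left)

lemma residual_orthogonal:
  assumes "orthogonal_up_to m u" "i < m"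
  shows "B (u i) (residual u m z) = 0"
proof -
  have "B (u i) (residual u m z) = B (u i) z - (\<Sum>j<m. (B (u j) z / B (u j) (u j)) * B (u i) (u j))"
    by (simp add: residual_def diff_right sum_right scaleR_right)
  also have "(\<Sum>j<m. (B (u j) z / B (u j) (u j)) * B (u i) (u j)) = (\<Sum>j\<in>{i}. (B (u j) z / B (u j) (u j)) * B (u i) (u j))"
    using assms by (intro sum.mono_neutral_right) (auto simp: orthogonal_up_to_def)
  also have "\<dots> = B (u i) z"
    using form_eq_0_iff[of "u i"] by (auto simp: zero_left)
  finally show ?thesis by simp
qed

lemma gs_orthogonal: "orthogonal_up_to m (gs x)"
proof (induction m)
  case (Suc m)
  from residual_orthogonal[OF this, of _ "x m"] have "B (gs x i) (gs x m) = 0" if "i < m" for i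
    using that by (simp add: gs_eq_residual[of x m])
  then show ?case
    using Suc sym by (auto simp: orthogonal_up_to_def less_Suc_eq)
qed (simp add: orthogonal_up_to_def)

lemma residual_add: "residual u m (y + z) = residual u m y + residual u m z"
  by (simp add: residual_def add_right add_divide_distrib scaleR_add_left sum.distrib)

lemma residual_scaleR: "residual u m (c *\<^sub>R z) = c *\<^sub>R residual u m z"
  by (simp add: residual_def scaleR_right scaleR_diff_right scaleR_sum_right)

lemma residual_next:
  assumes "orthogonal_up_to (Suc m) u"
  shows "residual u m (u m) = u m"
  using assms by (simp add: residual_def orthogonal_up_to_def)

lemma residual_Suc: "residual u (Suc m) z = residual u m z - (B (u m) z / B (u m) (u m)) *\<^sub>R u m"
  by (simp add: residual_def)

lemma residual_in_span: "z - residual u m z \<in> span (u ` {..<m})"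
  by (auto simp: residual_def intro!: span_sum span_scale intro: span_base)

lemma measurable_residual [measurable (raw)]:
  assumes "\<And>j. j < m \<Longrightarrow> (\<lambda>w. u w j) \<in> borel_measurable N" and [measurable]: "z \<in> borel_measurable N"
  shows "(\<lambda>w. residual (u w) m (z w)) \<in> borel_measurable N"
  unfolding residual_def using assms by (intro borel_measurable_diff borel_measurable_sum borel_measurable_scaleR
    borel_measurable_divide measurable_form) auto

text \<open>
  Removing one more direction from the residual removes one squared standard normal from its squared
  length, by resampling along that direction. Each such square contributes a factor
  \<open>1 / sqrt (1 + t)\<close>; the product form spares the subtraction of exponents during the induction.
\<close>
lemma laplace_residual_times:
  assumes t: "0 \<le> t" and "orthogonal_up_to m u" "\<And>j. j < m \<Longrightarrow> u j \<noteq> 0"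
  shows "(\<integral>\<^sup>+ z. ennreal (exp (- t * B (residual u m z) (residual u m z) / 2)) \<partial>\<gamma>)
      * ennreal ((1 / sqrt (1 + t)) ^ m) = ennreal ((1 / sqrt (1 + t)) ^ DIM('a))"
  using assms(2,3)
proof (induction m)
  case 0
  then show ?case using laplace_form[OF t] by (simp add: residual_def)
next
  case (Suc m)
  define v where "v = (1 / sqrt (B (u m) (u m))) *\<^sub>R u m"
  define Q where "Q m z = B (residual u m z) (residual u m z)" for m z
  have um: "0 < B (u m) (u m)" using pos Suc.prems(2) by simp
  then have v1: "B v v = 1" by (simp add: v_def scaleR_left scaleR_right)
  \<comment> \<open>Pythagoras: the resampled component is orthogonal to the next residual.\<close>
  have Q: "Q m (z + (s - B v z) *\<^sub>R v) = Q (Suc m) z + s\<^sup>2" for z s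
  proof -
    have rv: "residual u m v = v"
      using residual_next[OF Suc.prems(1)] by (simp add: v_def residual_scaleR)
    have "residual u m (z + (s - B v z) *\<^sub>R v) = residual u m z + (s - B v z) *\<^sub>R v"
      by (simp add: residual_add residual_scaleR rv)
    also have "\<dots> = residual u (Suc m) z + s *\<^sub>R v"
      using um by (simp add: residual_Suc v_def scaleR_left algebra_simps)
    finally have eq: "residual u m (z + (s - B v z) *\<^sub>R v) = residual u (Suc m) z + s *\<^sub>R v" .
    have "B v (residual u (Suc m) z) = 0"
      using residual_orthogonal[OF Suc.prems(1), of m z] by (simp add: v_def scaleR_left)
    then show ?thesis
      unfolding Q_def eq using sym[of v "residual u (Suc m) z"] v1
      by (simp add: add_left add_right scaleR_left scaleR_right power2_eq_square)
  qed
  have [measurable]: "Q m \<in> borel_measurable borel" for m unfolding Q_def by measurable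
  have "(\<integral>\<^sup>+ z. ennreal (exp (- t * Q m z / 2)) \<partial>\<gamma>)
     = (\<integral>\<^sup>+ z. \<integral>\<^sup>+ s. ennreal (std_normal_density s) * ennreal (exp (- t * (Q (Suc m) z + s\<^sup>2) / 2)) \<partial>lborel \<partial>\<gamma>)"
    by (subst nn_integral_resample[OF v1]) (simp_all add: Q)
  also have "\<dots> = (\<integral>\<^sup>+ z. \<integral>\<^sup>+ s. ennreal (exp (- t * Q (Suc m) z / 2))
      * (ennreal (std_normal_density s) * ennreal (exp (- t * s\<^sup>2 / 2))) \<partial>lborel \<partial>\<gamma>)"
  proof (intro nn_integral_cong)
    fix z s
    have "exp (- t * (Q (Suc m) z + s\<^sup>2) / 2) = exp (- t * Q (Suc m) z / 2) * exp (- t * s\<^sup>2 / 2)"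
      by (subst exp_add[symmetric]) (simp add: algebra_simps diff_divide_distrib)
    then show "ennreal (std_normal_density s) * ennreal (exp (- t * (Q (Suc m) z + s\<^sup>2) / 2))
      = ennreal (exp (- t * Q (Suc m) z / 2)) * (ennreal (std_normal_density s) * ennreal (exp (- t * s\<^sup>2 / 2)))"
      by (simp only: ennreal_mult exp_ge_zero mult.left_commute)
  qed
  also have "\<dots> = (\<integral>\<^sup>+ z. ennreal (exp (- t * Q (Suc m) z / 2)) * ennreal (1 / sqrt (1 + t)) \<partial>\<gamma>)"
    by (subst nn_integral_cmult) (simp_all only: laplace_1d[OF t], measurable)
  also have "\<dots> = (\<integral>\<^sup>+ z. ennreal (exp (- t * Q (Suc m) z / 2)) \<partial>\<gamma>) * ennreal (1 / sqrt (1 + t))"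
    by (rule nn_integral_multc) measurable
  finally have step: "(\<integral>\<^sup>+ z. ennreal (exp (- t * Q m z / 2)) \<partial>\<gamma>)
    = (\<integral>\<^sup>+ z. ennreal (exp (- t * Q (Suc m) z / 2)) \<partial>\<gamma>) * ennreal (1 / sqrt (1 + t))" .
  have "orthogonal_up_to m u" "\<And>j. j < m \<Longrightarrow> u j \<noteq> 0"
    using Suc.prems by (auto simp: orthogonal_up_to_def)
  from Suc.IH[OF this] show ?case
    unfolding Q_def[symmetric] step power_Suc
    using t by (subst ennreal_mult) (auto simp: mult.assoc)
qed

lemma laplace_residual:
  assumes t: "0 \<le> t" and "orthogonal_up_to m u" "\<And>j. j < m \<Longrightarrow> u j \<noteq> 0" and "m \<le> DIM('a)"
  shows "(\<integral>\<^sup>+ z. ennreal (exp (- t * B (residual u m z) (residual u m z) / 2)) \<partial>\<gamma>)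
    = ennreal ((1 / sqrt (1 + t)) ^ (DIM('a) - m))" (is "?I = _")
proof -
  define c where "c = (1 / sqrt (1 + t)) ^ m"
  have c: "0 < c" using t by (simp add: c_def)
  have "?I = ?I * ennreal c / ennreal c"
    using c by (intro ennreal_mult_divide_eq[symmetric]) auto
  also have "\<dots> = ennreal ((1 / sqrt (1 + t)) ^ DIM('a) / c)"
    using laplace_residual_times[OF assms(1-3)] c t by (simp add: c_def[symmetric] divide_ennreal)
  also have "(1 / sqrt (1 + t)) ^ DIM('a) / c = (1 / sqrt (1 + t)) ^ (DIM('a) - m)"
    unfolding c_def using t assms(4) by (subst power_diff) auto
  finally show ?thesis .
qed

text \<open>The residual vanishes only on the span of fewer than \<open>DIM('a)\<close> vectors, a null set.\<close>
lemma AE_residual_nonzero: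
  assumes "m < DIM('a)"
  shows "AE z in lborel. residual u m z \<noteq> 0"
proof -
  have "dim (span (u ` {..<m})) \<le> card (u ` {..<m})"
    by (simp add: dim_le_card')
  also have "\<dots> \<le> m"
    using card_image_le[of "{..<m}" u] by simp
  finally have "negligible (span (u ` {..<m}))"
    using assms by (intro negligible_lowdim) simp
  moreover have "residual u m z \<noteq> 0" if "z \<notin> span (u ` {..<m})" for z
    using that residual_in_span[of z u m] by auto
  ultimately show ?thesis
    by (intro AE_I'[of "span (u ` {..<m})"])
      (auto simp: negligible_iff_null_sets null_sets_def closed_subspace intro!: borel_closed)
qed

lemma AE_\<gamma>_if_AE_lborel: "AE z in lborel. R z \<Longrightarrow> AE z in \<gamma>. R z"
  unfolding \<gamma>_def by (subst AE_density) (auto elim!: eventually_mono)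

lemma expectation_inverse_square_residual:
  assumes "orthogonal_up_to m u" "\<And>j. j < m \<Longrightarrow> u j \<noteq> 0" and "m + 3 \<le> DIM('a)"
  shows "(\<integral>\<^sup>+ z. ennreal (1 / B (residual u m z) (residual u m z)) \<partial>\<gamma>) \<le> ennreal (1 / (real DIM('a) - real m - 2))"
proof -
  interpret prob_space \<gamma> by (rule prob_space_\<gamma>)
  have "(\<integral>\<^sup>+ z. ennreal (1 / B (residual u m z) (residual u m z)) \<partial>\<gamma>) \<le> ennreal (1 / (real (DIM('a) - m) - 2))"
    using assms by (intro nn_integral_inverse_from_laplace laplace_residual form_nonneg sigma_finite_measure_axioms) auto
  then show ?thesis using assms by (simp add: of_nat_diff)
qed

lemma expectation_inverse_residual:
  assumes "orthogonal_up_to m u" "\<And>j. j < m \<Longrightarrow> u j \<noteq> 0" and "m + 2 \<le> DIM('a)"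
  shows "ennreal (1 / sqrt (real DIM('a) - real m - 1)) \<le> (\<integral>\<^sup>+ z. ennreal (1 / sqrt (B (residual u m z) (residual u m z))) \<partial>\<gamma>)"
proof -
  interpret prob_space \<gamma> by (rule prob_space_\<gamma>)
  have "AE z in \<gamma>. 0 < B (residual u m z) (residual u m z)"
    using assms AE_\<gamma>_if_AE_lborel[OF AE_residual_nonzero[of m u]] by (auto elim!: eventually_mono intro: pos)
  then have "ennreal (1 / sqrt (real (DIM('a) - m) - 1)) \<le> (\<integral>\<^sup>+ z. ennreal (1 / sqrt (B (residual u m z) (residual u m z))) \<partial>\<gamma>)"
    using assms by (intro nn_integral_inverse_sqrt_from_laplace laplace_residual sigma_finite_measure_axioms) auto
  then show ?thesis using assms by (simp add: of_nat_diff)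
qed

lemma measurable_gs [measurable (raw)]:
  assumes "\<And>i. i \<le> m \<Longrightarrow> (\<lambda>w. x w i) \<in> borel_measurable N"
  shows "(\<lambda>w. gs (x w) m) \<in> borel_measurable N"
  using assms
proof (induction m rule: less_induct)
  case (less m)
  then show ?case
    unfolding gs_eq_residual[of _ m] by (intro measurable_residual) auto
qed

text \<open>
  Add the rows one at a time. The measure \<open>M\<close> is kept abstract because the statement is needed both for
  \<open>\<gamma>\<close>, to compute moments, and for Lebesgue measure, over which the densities are integrated.
\<close>
lemma AE_gs_nonzero:
  assumes M: "sigma_finite_measure M" "sets M = sets borel"
    and ac: "\<And>R. AE z in lborel. R z \<Longrightarrow> AE z in M. R z"
    and "n \<le> DIM('a)"
  shows "AE x in PiM {..<n} (\<lambda>_. M). \<forall>j<n. gs x j \<noteq> 0"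
  using assms(4)
proof (induction n)
  case (Suc n)
  interpret sigma_finite_measure M by (rule M)
  interpret product_sigma_finite "\<lambda>_::nat. M" ..
  note [measurable_cong] = M(2)
  define bad where "bad n x = (if \<forall>j<n. gs x j \<noteq> 0 then 0 else 1 :: ennreal)" for n x
  have bad_meas: "bad n \<in> borel_measurable (PiM {..<n} (\<lambda>_. M))" for n
    unfolding bad_def by measurable
  have upd: "bad (Suc n) (x(n := z)) = max (bad n x) (if residual (gs x) n z \<noteq> 0 then 0 else 1)" for x z
  proof -
    have "gs (x(n := z)) j = gs x j" if "j < n" for j
      using that by (intro gs_cong) auto
    then show ?thesis
      by (subst gs_eq_residual[of _ n] | auto simp: bad_def less_Suc_eq gs_eq_residual[of _ n] residual_def)+
  qed
  have "(\<integral>\<^sup>+ x. bad (Suc n) x \<partial>PiM {..<Suc n} (\<lambda>_. M))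
      = (\<integral>\<^sup>+ x. \<integral>\<^sup>+ z. bad (Suc n) (x(n := z)) \<partial>M \<partial>PiM {..<n} (\<lambda>_. M))"
    using bad_meas[of "Suc n"] unfolding lessThan_Suc[of n]
    by (subst product_nn_integral_insert) auto
  also have "\<dots> = (\<integral>\<^sup>+ x. 0 \<partial>PiM {..<n} (\<lambda>_. M))"
  proof (rule nn_integral_cong_AE)
    from Suc have "AE x in PiM {..<n} (\<lambda>_. M). \<forall>j<n. gs x j \<noteq> 0" by simp
    then show "AE x in PiM {..<n} (\<lambda>_. M). (\<integral>\<^sup>+ z. bad (Suc n) (x(n := z)) \<partial>M) = 0"
    proof eventually_elim
      case (elim x)
      have "AE z in M. residual (gs x) n z \<noteq> 0"
        using Suc.prems by (intro ac AE_residual_nonzero) simp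
      then have "AE z in M. bad (Suc n) (x(n := z)) = 0"
        by eventually_elim (use elim in \<open>simp add: upd, simp add: bad_def\<close>)
      then have "(\<integral>\<^sup>+ z. bad (Suc n) (x(n := z)) \<partial>M) = (\<integral>\<^sup>+ z. 0 \<partial>M)"
        by (rule nn_integral_cong_AE)
      then show ?case by simp
    qed
  qed
  finally have "AE x in PiM {..<Suc n} (\<lambda>_. M). bad (Suc n) x = 0"
    using bad_meas[of "Suc n"] by (simp add: nn_integral_0_iff_AE)
  then show ?case
    by eventually_elim (auto simp: bad_def split: if_splits)
qed simp

text \<open>
  The last Gram--Schmidt vector is the residual of the last row given the earlier ones. The inner
  integral on the right depends on the earlier rows, if these are linearly independent, only through
  their number, so that the moments of the product factorise.
\<close>
lemma nn_integral_gs_prod_Suc: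
  fixes h :: "real \<Rightarrow> ennreal"
  assumes [measurable]: "h \<in> borel_measurable borel"
  shows "(\<integral>\<^sup>+ x. (\<Prod>j<Suc n. h (B (gs x j) (gs x j))) \<partial>PiM {..<Suc n} (\<lambda>_. \<gamma>))
    = (\<integral>\<^sup>+ x. (\<Prod>j<n. h (B (gs x j) (gs x j))) * (\<integral>\<^sup>+ z. h (B (residual (gs x) n z) (residual (gs x) n z)) \<partial>\<gamma>)
        \<partial>PiM {..<n} (\<lambda>_. \<gamma>))"
proof -
  interpret prob_space \<gamma> by (rule prob_space_\<gamma>)
  interpret product_sigma_finite "\<lambda>_::nat. \<gamma>" ..
  have meas: "(\<lambda>x. \<Prod>j<Suc n. h (B (gs x j) (gs x j))) \<in> borel_measurable (PiM {..<Suc n} (\<lambda>_. \<gamma>))"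
    by (intro borel_measurable_prod_ennreal) measurable
  have "(\<integral>\<^sup>+ x. (\<Prod>j<Suc n. h (B (gs x j) (gs x j))) \<partial>PiM {..<Suc n} (\<lambda>_. \<gamma>))
    = (\<integral>\<^sup>+ x. \<integral>\<^sup>+ z. (\<Prod>j<Suc n. h (B (gs (x(n := z)) j) (gs (x(n := z)) j))) \<partial>\<gamma> \<partial>PiM {..<n} (\<lambda>_. \<gamma>))"
    using meas unfolding lessThan_Suc[of n] by (subst product_nn_integral_insert) auto
  also have "\<dots> = (\<integral>\<^sup>+ x. \<integral>\<^sup>+ z. (\<Prod>j<n. h (B (gs x j) (gs x j))) * h (B (residual (gs x) n z) (residual (gs x) n z)) \<partial>\<gamma> \<partial>PiM {..<n} (\<lambda>_. \<gamma>))"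
  proof (intro nn_integral_cong)
    fix x z
    have "gs (x(n := z)) j = gs x j" if "j < n" for j
      using that by (intro gs_cong) auto
    moreover from this have "gs (x(n := z)) n = residual (gs x) n z"
      by (simp add: gs_eq_residual[of _ n] residual_def)
    ultimately show "(\<Prod>j<Suc n. h (B (gs (x(n := z)) j) (gs (x(n := z)) j)))
        = (\<Prod>j<n. h (B (gs x j) (gs x j))) * h (B (residual (gs x) n z) (residual (gs x) n z))"
      by simp
  qed
  also have "\<dots> = (\<integral>\<^sup>+ x. (\<Prod>j<n. h (B (gs x j) (gs x j))) * (\<integral>\<^sup>+ z. h (B (residual (gs x) n z) (residual (gs x) n z)) \<partial>\<gamma>)
        \<partial>PiM {..<n} (\<lambda>_. \<gamma>))"
    by (intro nn_integral_cong nn_integral_cmult) measurable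
  finally show ?thesis .
qed

lemma AE_gs_nonzero_\<gamma>:
  "n \<le> DIM('a) \<Longrightarrow> AE x in PiM {..<n} (\<lambda>_. \<gamma>). \<forall>j<n. gs x j \<noteq> 0"
  using prob_space_\<gamma>
  by (intro AE_gs_nonzero AE_\<gamma>_if_AE_lborel) (auto simp: prob_space_def finite_measure_def)

lemma second_moment_inverse_volume:
  assumes "n + 2 \<le> DIM('a)"
  shows "(\<integral>\<^sup>+ x. (\<Prod>j<n. ennreal (1 / B (gs x j) (gs x j))) \<partial>PiM {..<n} (\<lambda>_. \<gamma>))
    \<le> (\<Prod>j<n. ennreal (1 / (real DIM('a) - real j - 2)))"
  using assms
proof (induction n)
  case 0
  interpret prob_space "PiM {} (\<lambda>_::nat. \<gamma>)" by (intro prob_space_PiM prob_space_\<gamma>)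
  show ?case by (simp add: emeasure_space_1)
next
  case (Suc n)
  have "(\<integral>\<^sup>+ x. (\<Prod>j<Suc n. ennreal (1 / B (gs x j) (gs x j))) \<partial>PiM {..<Suc n} (\<lambda>_. \<gamma>))
      = (\<integral>\<^sup>+ x. (\<Prod>j<n. ennreal (1 / B (gs x j) (gs x j)))
          * (\<integral>\<^sup>+ z. ennreal (1 / B (residual (gs x) n z) (residual (gs x) n z)) \<partial>\<gamma>) \<partial>PiM {..<n} (\<lambda>_. \<gamma>))"
    by (rule nn_integral_gs_prod_Suc) measurable
  also have "\<dots> \<le> (\<integral>\<^sup>+ x. (\<Prod>j<n. ennreal (1 / B (gs x j) (gs x j))) * ennreal (1 / (real DIM('a) - real n - 2)) \<partial>PiM {..<n} (\<lambda>_. \<gamma>))"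
  proof (rule nn_integral_mono_AE)
    from Suc.prems have "AE x in PiM {..<n} (\<lambda>_. \<gamma>). \<forall>j<n. gs x j \<noteq> 0" by (intro AE_gs_nonzero_\<gamma>) simp
    then show "AE x in PiM {..<n} (\<lambda>_. \<gamma>). (\<Prod>j<n. ennreal (1 / B (gs x j) (gs x j)))
          * (\<integral>\<^sup>+ z. ennreal (1 / B (residual (gs x) n z) (residual (gs x) n z)) \<partial>\<gamma>)
        \<le> (\<Prod>j<n. ennreal (1 / B (gs x j) (gs x j))) * ennreal (1 / (real DIM('a) - real n - 2))"
      by eventually_elim
        (use Suc.prems in \<open>intro mult_left_mono expectation_inverse_square_residual gs_orthogonal; simp\<close>)
  qed
  also have "\<dots> = (\<integral>\<^sup>+ x. (\<Prod>j<n. ennreal (1 / B (gs x j) (gs x j))) \<partial>PiM {..<n} (\<lambda>_. \<gamma>)) * ennreal (1 / (real DIM('a) - real n - 2))"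
    by (intro nn_integral_multc borel_measurable_prod_ennreal) measurable
  also have "\<dots> \<le> (\<Prod>j<n. ennreal (1 / (real DIM('a) - real j - 2))) * ennreal (1 / (real DIM('a) - real n - 2))"
    using Suc by (intro mult_right_mono) auto
  finally show ?case by simp
qed

lemma first_moment_inverse_volume:
  assumes "n + 1 \<le> DIM('a)"
  shows "(\<Prod>j<n. ennreal (1 / sqrt (real DIM('a) - real j - 1)))
    \<le> (\<integral>\<^sup>+ x. (\<Prod>j<n. ennreal (1 / sqrt (B (gs x j) (gs x j)))) \<partial>PiM {..<n} (\<lambda>_. \<gamma>))"
  using assms
proof (induction n)
  case 0
  interpret prob_space "PiM {} (\<lambda>_::nat. \<gamma>)" by (intro prob_space_PiM prob_space_\<gamma>)
  show ?case by (simp add: emeasure_space_1)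
next
  case (Suc n)
  have "(\<Prod>j<Suc n. ennreal (1 / sqrt (real DIM('a) - real j - 1)))
      \<le> (\<integral>\<^sup>+ x. (\<Prod>j<n. ennreal (1 / sqrt (B (gs x j) (gs x j)))) \<partial>PiM {..<n} (\<lambda>_. \<gamma>)) * ennreal (1 / sqrt (real DIM('a) - real n - 1))"
    using Suc by (simp add: mult_right_mono)
  also have "\<dots> = (\<integral>\<^sup>+ x. (\<Prod>j<n. ennreal (1 / sqrt (B (gs x j) (gs x j)))) * ennreal (1 / sqrt (real DIM('a) - real n - 1)) \<partial>PiM {..<n} (\<lambda>_. \<gamma>))"
    by (intro nn_integral_multc[symmetric] borel_measurable_prod_ennreal) measurable
  also have "\<dots> \<le> (\<integral>\<^sup>+ x. (\<Prod>j<n. ennreal (1 / sqrt (B (gs x j) (gs x j))))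
          * (\<integral>\<^sup>+ z. ennreal (1 / sqrt (B (residual (gs x) n z) (residual (gs x) n z))) \<partial>\<gamma>) \<partial>PiM {..<n} (\<lambda>_. \<gamma>))"
  proof (rule nn_integral_mono_AE)
    from Suc.prems have "AE x in PiM {..<n} (\<lambda>_. \<gamma>). \<forall>j<n. gs x j \<noteq> 0" by (intro AE_gs_nonzero_\<gamma>) simp
    then show "AE x in PiM {..<n} (\<lambda>_. \<gamma>).
        (\<Prod>j<n. ennreal (1 / sqrt (B (gs x j) (gs x j)))) * ennreal (1 / sqrt (real DIM('a) - real n - 1))
        \<le> (\<Prod>j<n. ennreal (1 / sqrt (B (gs x j) (gs x j))))
          * (\<integral>\<^sup>+ z. ennreal (1 / sqrt (B (residual (gs x) n z) (residual (gs x) n z))) \<partial>\<gamma>)"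
      by eventually_elim
        (use Suc.prems in \<open>intro mult_left_mono expectation_inverse_residual gs_orthogonal; simp\<close>)
  qed
  also have "\<dots> = (\<integral>\<^sup>+ x. (\<Prod>j<Suc n. ennreal (1 / sqrt (B (gs x j) (gs x j)))) \<partial>PiM {..<Suc n} (\<lambda>_. \<gamma>))"
    by (rule nn_integral_gs_prod_Suc[symmetric]) measurable
  finally show ?case .
qed

section \<open>The joint density of finitely many linear forms\<close>

text \<open>
  The Gram--Schmidt recursion for \<open>x\<close>, with the same coefficients, applied to scalars. By linearity it
  sends the responses \<open>B (x i) b\<close> to the values \<open>B (gs x j) b\<close>, which are independent for Gaussian \<open>b\<close>.
\<close>
fun whiten :: "(nat \<Rightarrow> 'a) \<Rightarrow> (nat \<Rightarrow> real) \<Rightarrow> nat \<Rightarrow> real" where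
  "whiten x y m = y m - (\<Sum>j<m. B (gs x j) (x m) / B (gs x j) (gs x j) * whiten x y j)"

declare whiten.simps [simp del]

lemma whiten_cong:
  assumes "\<And>i. i \<le> m \<Longrightarrow> x i = x' i" and "\<And>i. i \<le> m \<Longrightarrow> y i = y' i"
  shows "whiten x y m = whiten x' y' m"
  using assms
proof (induction m rule: less_induct)
  case (less m)
  have "gs x j = gs x' j" if "j \<le> m" for j
    using that less.prems by (intro gs_cong) auto
  then show ?case
    using less by (subst (1 2) whiten.simps) (auto intro!: sum.cong)
qed

lemma whiten_form: "whiten x (\<lambda>i. R * B (x i) b) m = R * B (gs x m) b"
proof (induction m rule: less_induct)
  case (less m)
  have "whiten x (\<lambda>i. R * B (x i) b) m
      = R * B (x m) b - (\<Sum>j<m. B (gs x j) (x m) / B (gs x j) (gs x j) * (R * B (gs x j) b))"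
    using less by (subst whiten.simps) simp
  also have "\<dots> = R * B (gs x m) b"
    by (subst (5) gs.simps) (simp add: diff_left sum_left scaleR_left right_diff_distrib sum_distrib_left mult_ac)
  finally show ?case .
qed

lemma measurable_whiten [measurable (raw)]:
  assumes "\<And>i. i \<le> m \<Longrightarrow> (\<lambda>w. x w i) \<in> borel_measurable N"
    and "\<And>i. i \<le> m \<Longrightarrow> (\<lambda>w. y w i) \<in> borel_measurable N"
  shows "(\<lambda>w. whiten (x w) (y w) m) \<in> borel_measurable N"
  using assms
proof (induction m rule: less_induct)
  case (less m)
  then show ?case
    by (subst whiten.simps) (intro borel_measurable_diff borel_measurable_sum borel_measurable_times
      borel_measurable_divide measurable_form measurable_gs; auto)
qed

lemma gs_expand: "x m = gs x m + (\<Sum>i<m. (B (gs x i) (x m) / B (gs x i) (gs x i)) *\<^sub>R gs x i)"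
  using gs.simps[of x m] by simp

lemma gs_orthogonal_pair: "i < n \<Longrightarrow> B (gs x i) (gs x n) = 0"
  using gs_orthogonal[of "Suc n" x] by (auto simp: orthogonal_up_to_def)

lemma form_gs_later: "j < n \<Longrightarrow> B (x j) (gs x n) = 0"
  using arg_cong[OF gs_expand[of x j], of "\<lambda>z. B z (gs x n)"]
  by (simp add: add_left sum_left scaleR_left gs_orthogonal_pair)

lemma form_gs_self: "B (x n) (gs x n) = B (gs x n) (gs x n)"
  using arg_cong[OF gs_expand[of x n], of "\<lambda>z. B z (gs x n)"]
  by (simp add: add_left sum_left scaleR_left gs_orthogonal_pair)

text \<open>
  Induction on the number of forms. Resampling \<open>b\<close> along the last Gram--Schmidt vector leaves the earlier
  forms unchanged and makes the last one normal, centred at a linear function of the earlier ones.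
  Since the recursion \<open>whiten\<close> is unitriangular, no Jacobian appears.
\<close>
lemma nn_integral_forms:
  assumes "0 < R" and "\<And>j. j < n \<Longrightarrow> gs x j \<noteq> 0" and "f \<in> borel_measurable (PiM {..<n} (\<lambda>_. lborel))"
  shows "(\<integral>\<^sup>+ b. f (\<lambda>i\<in>{..<n}. R * B (x i) b) \<partial>\<gamma>)
    = (\<integral>\<^sup>+ y. f y * (\<Prod>j<n. ennreal (normal_density 0 (R * sqrt (B (gs x j) (gs x j))) (whiten x y j)))
        \<partial>PiM {..<n} (\<lambda>_. lborel))"
  using assms(2,3)
proof (induction n arbitrary: f)
  case 0
  interpret prob_space \<gamma> by (rule prob_space_\<gamma>)
  interpret product_sigma_finite "\<lambda>_::nat. lborel :: real measure" ..
  have "(\<lambda>i\<in>{..<0}. R * B (x i) b) = (\<lambda>_. undefined)" for b by (auto simp: restrict_def)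
  then show ?case
    using emeasure_space_1 by (simp add: nn_integral_empty restrict_def lessThan_0)
next
  case (Suc n)
  interpret product_sigma_finite "\<lambda>_::nat. lborel :: real measure" ..
  note [measurable] = Suc.prems(2)
  define u where "u = gs x n"
  define \<sigma> where "\<sigma> = sqrt (B u u)"
  define v where "v = (1 / \<sigma>) *\<^sub>R u"
  define shift where "shift y = (\<Sum>j<n. B (gs x j) (x n) / B (gs x j) (gs x j) * whiten x y j)" for y
  define Y where "Y b = (\<lambda>i\<in>{..<n}. R * B (x i) b)" for b
  define dens where "dens y = (\<Prod>j<n. ennreal (normal_density 0 (R * sqrt (B (gs x j) (gs x j))) (whiten x y j)))" for y
  define G where "G y = (\<integral>\<^sup>+ z. ennreal (normal_density 0 (R * \<sigma>) (z - shift y)) * f (y(n := z)) \<partial>lborel)" for y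
  have um: "0 < B u u" using pos Suc.prems(1) by (simp add: u_def)
  then have \<sigma>: "0 < \<sigma>" "\<sigma> * \<sigma> = B u u" by (simp_all add: \<sigma>_def)
  have v1: "B v v = 1" using um \<sigma> by (simp add: v_def scaleR_left scaleR_right)
  have [measurable]: "shift \<in> borel_measurable (PiM {..<n} (\<lambda>_. lborel))"
    unfolding shift_def by measurable
  have [measurable]: "dens \<in> borel_measurable (PiM {..<n} (\<lambda>_. lborel))"
    unfolding dens_def by measurable
  have upd [measurable]: "(\<lambda>(y, z). y(n := z)) \<in> PiM {..<n} (\<lambda>_. lborel) \<Otimes>\<^sub>M borel \<rightarrow>\<^sub>M PiM {..<Suc n} (\<lambda>_. lborel :: real measure)"
    unfolding lessThan_Suc by measurable
  have G_meas [measurable]: "G \<in> borel_measurable (PiM {..<n} (\<lambda>_. lborel))"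
    unfolding G_def by measurable
  have Y_meas [measurable]: "Y \<in> borel \<rightarrow>\<^sub>M PiM {..<n} (\<lambda>_. lborel)"
    unfolding Y_def by (intro measurable_restrict) simp
  \<comment> \<open>Resampling changes only the last response, which becomes an affine function of \<open>t\<close>.\<close>
  have moved: "(\<lambda>i\<in>{..<Suc n}. R * B (x i) (b + (t - B v b) *\<^sub>R v)) = (Y b)(n := shift (Y b) + (R * \<sigma>) * t)" for b t
  proof
    fix i
    have shift_eq: "shift (Y b) = R * B (x n) b - R * B u b"
    proof -
      have "shift (Y b) = shift (\<lambda>i. R * B (x i) b)"
        unfolding shift_def by (intro sum.cong arg_cong2[where f="(*)"] refl whiten_cong) (auto simp: Y_def)
      also have "\<dots> = R * B (x n) b - whiten x (\<lambda>i. R * B (x i) b) n"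
        using whiten.simps[of x "\<lambda>i. R * B (x i) b" n] by (simp add: shift_def)
      finally show ?thesis by (simp add: whiten_form u_def)
    qed
    consider "i < n" | "i = n" | "n < i" by linarith
    then show "(\<lambda>i\<in>{..<Suc n}. R * B (x i) (b + (t - B v b) *\<^sub>R v)) i = ((Y b)(n := shift (Y b) + (R * \<sigma>) * t)) i"
    proof cases
      case 1
      then show ?thesis
        using form_gs_later[of i n x] by (simp add: Y_def add_right scaleR_right v_def u_def)
    next
      case 2
      have "B (x n) v = \<sigma>"
        using form_gs_self[of x n] \<sigma> by (simp add: v_def scaleR_right u_def[symmetric] field_simps)
      moreover have "B u b = \<sigma> * B v b"
        using \<sigma> by (simp add: v_def scaleR_left)
      ultimately show ?thesis
        using 2 by (simp add: shift_eq add_right diff_right scaleR_right algebra_simps)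
    qed (simp add: Y_def)
  qed
  \<comment> \<open>The affine change of variable from \<open>t\<close> to the last response \<open>z\<close>.\<close>
  have inner: "(\<integral>\<^sup>+ t. ennreal (std_normal_density t) * f (y(n := shift y + (R * \<sigma>) * t)) \<partial>lborel) = G y"
    if y: "y \<in> space (PiM {..<n} (\<lambda>_. lborel))" for y
  proof -
    have [measurable]: "(\<lambda>z. f (y(n := z))) \<in> borel_measurable borel"
      using measurable_compose[OF measurable_Pair1'[OF y] measurable_compose[OF upd Suc.prems(2)]] by (simp add: fun_upd_def)
    have "G y = ennreal \<bar>R * \<sigma>\<bar> * (\<integral>\<^sup>+ t. ennreal (normal_density 0 (R * \<sigma>) (shift y + (R * \<sigma>) * t - shift y))
        * f (y(n := shift y + (R * \<sigma>) * t)) \<partial>lborel)"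
      unfolding G_def using \<sigma> \<open>0 < R\<close> by (subst nn_integral_real_affine[where c="R * \<sigma>" and t="shift y"]) auto
    also have "\<dots> = (\<integral>\<^sup>+ t. ennreal \<bar>R * \<sigma>\<bar> * (ennreal (normal_density 0 (R * \<sigma>) (shift y + (R * \<sigma>) * t - shift y))
        * f (y(n := shift y + (R * \<sigma>) * t))) \<partial>lborel)"
      by (rule nn_integral_cmult[symmetric]) measurable
    also have "\<dots> = (\<integral>\<^sup>+ t. ennreal (std_normal_density t) * f (y(n := shift y + (R * \<sigma>) * t)) \<partial>lborel)"
    proof (intro nn_integral_cong)
      fix t
      have "(R * \<sigma>) * normal_density 0 (R * \<sigma>) ((R * \<sigma>) * t) = std_normal_density t"
        using \<sigma>(1) \<open>0 < R\<close> by (simp add: normal_density_def power_mult_distrib real_sqrt_mult)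
      then have "ennreal \<bar>R * \<sigma>\<bar> * ennreal (normal_density 0 (R * \<sigma>) (shift y + (R * \<sigma>) * t - shift y)) = ennreal (std_normal_density t)"
        using \<sigma>(1) \<open>0 < R\<close> by (subst ennreal_mult[symmetric]) auto
      then show "ennreal \<bar>R * \<sigma>\<bar> * (ennreal (normal_density 0 (R * \<sigma>) (shift y + (R * \<sigma>) * t - shift y))
          * f (y(n := shift y + (R * \<sigma>) * t))) = ennreal (std_normal_density t) * f (y(n := shift y + (R * \<sigma>) * t))"
        by (simp only: mult.assoc[symmetric])
    qed
    finally show ?thesis by simp
  qed
  have "(\<integral>\<^sup>+ b. f (\<lambda>i\<in>{..<Suc n}. R * B (x i) b) \<partial>\<gamma>)
      = (\<integral>\<^sup>+ b. \<integral>\<^sup>+ t. ennreal (std_normal_density t) * f ((Y b)(n := shift (Y b) + (R * \<sigma>) * t)) \<partial>lborel \<partial>\<gamma>)"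
    by (subst nn_integral_resample[OF v1]) (simp_all add: moved)
  also have "\<dots> = (\<integral>\<^sup>+ b. G (Y b) \<partial>\<gamma>)"
    using measurable_space[OF Y_meas] by (intro nn_integral_cong inner) simp
  also have "\<dots> = (\<integral>\<^sup>+ y. G y * dens y \<partial>PiM {..<n} (\<lambda>_. lborel))"
    unfolding Y_def dens_def by (rule Suc.IH) (use Suc.prems(1) in auto)
  also have "\<dots> = (\<integral>\<^sup>+ y. \<integral>\<^sup>+ z. f (y(n := z)) *
      (\<Prod>j<Suc n. ennreal (normal_density 0 (R * sqrt (B (gs x j) (gs x j))) (whiten x (y(n := z)) j))) \<partial>lborel \<partial>PiM {..<n} (\<lambda>_. lborel))"
  proof (intro nn_integral_cong)
    fix y :: "nat \<Rightarrow> real" assume y: "y \<in> space (PiM {..<n} (\<lambda>_. lborel))"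
    have [measurable]: "(\<lambda>z. f (y(n := z))) \<in> borel_measurable borel"
      using measurable_compose[OF measurable_Pair1'[OF y] measurable_compose[OF upd Suc.prems(2)]] by (simp add: fun_upd_def)
    have w: "whiten x (y(n := z)) j = whiten x y j" if "j < n" for z j
      using that by (intro whiten_cong) auto
    have wn: "whiten x (y(n := z)) n = z - shift y" for z
      by (subst whiten.simps) (simp add: w shift_def)
    have "G y * dens y = (\<integral>\<^sup>+ z. ennreal (normal_density 0 (R * \<sigma>) (z - shift y)) * f (y(n := z)) * dens y \<partial>lborel)"
      unfolding G_def by (rule nn_integral_multc[symmetric]) measurable
    then show "G y * dens y = (\<integral>\<^sup>+ z. f (y(n := z)) *
      (\<Prod>j<Suc n. ennreal (normal_density 0 (R * sqrt (B (gs x j) (gs x j))) (whiten x (y(n := z)) j))) \<partial>lborel)"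
      by (simp add: w wn dens_def \<sigma>_def u_def mult_ac)
  qed
  also have "\<dots> = (\<integral>\<^sup>+ y. f y * (\<Prod>j<Suc n. ennreal (normal_density 0 (R * sqrt (B (gs x j) (gs x j))) (whiten x y j)))
        \<partial>PiM {..<Suc n} (\<lambda>_. lborel))"
    unfolding lessThan_Suc[of n]
    by (subst product_nn_integral_insert) (auto simp: lessThan_Suc[symmetric] simp del: prod.lessThan_Suc)
  finally show ?case .
qed

end

section \<open>Powers of densities and total variation\<close>

text \<open>Both sides agree on boxes, where the integral of the product factorises.\<close>
lemma iid_power_distr_density:
  assumes M: "sigma_finite_measure M"
    and q [measurable]: "q \<in> borel_measurable M" and g [measurable]: "g \<in> M \<rightarrow>\<^sub>M N"
    and prob: "prob_space (distr (density M q) N g)"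
  shows "iid_power n (distr (density M q) N g)
    = distr (density (PiM {..<n} (\<lambda>_. M)) (\<lambda>x. \<Prod>i<n. q (x i))) (PiM {..<n} (\<lambda>_. N)) (\<lambda>x. \<lambda>i\<in>{..<n}. g (x i))"
proof -
  let ?Q = "distr (density M q) N g"
  let ?N = "distr (density (PiM {..<n} (\<lambda>_. M)) (\<lambda>x. \<Prod>i<n. q (x i))) (PiM {..<n} (\<lambda>_. N)) (\<lambda>x. \<lambda>i\<in>{..<n}. g (x i))"
  interpret M: sigma_finite_measure M by fact
  interpret M: product_sigma_finite "\<lambda>_::nat. M" ..
  interpret Q: prob_space ?Q by fact
  interpret Q: product_sigma_finite "\<lambda>_::nat. ?Q" ..
  have "?N = PiM {..<n} (\<lambda>_. ?Q)"
  proof (rule Q.PiM_eqI)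
    show "sets ?N = sets (PiM {..<n} (\<lambda>_. ?Q))"
      by (simp cong: sets_PiM_cong)
  next
    fix A assume A: "\<And>i. i \<in> {..<n} \<Longrightarrow> A i \<in> sets ?Q"
    then have [measurable]: "i < n \<Longrightarrow> A i \<in> sets N" for i by simp
    have zip [measurable]: "(\<lambda>x. \<lambda>i\<in>{..<n}. g (x i)) \<in> PiM {..<n} (\<lambda>_. M) \<rightarrow>\<^sub>M PiM {..<n} (\<lambda>_. N)"
      by measurable
    have box: "Pi\<^sub>E {..<n} A \<in> sets (PiM {..<n} (\<lambda>_. N))"
      using A by (intro sets_PiM_I_finite) auto
    have "emeasure ?N (Pi\<^sub>E {..<n} A)
        = (\<integral>\<^sup>+ x. indicator (Pi\<^sub>E {..<n} A) x \<partial>?N)"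
      using box by simp
    also have "\<dots> = (\<integral>\<^sup>+ x. (\<Prod>i<n. q (x i)) * indicator (Pi\<^sub>E {..<n} A) (\<lambda>i\<in>{..<n}. g (x i)) \<partial>PiM {..<n} (\<lambda>_. M))"
      using box by (subst nn_integral_distr) (simp_all add: nn_integral_density)
    also have "\<dots> = (\<integral>\<^sup>+ x. (\<Prod>i<n. q (x i) * indicator (A i) (g (x i))) \<partial>PiM {..<n} (\<lambda>_. M))"
      by (intro nn_integral_cong) (auto simp: prod.distrib indicator_def PiE_iff prod_zero_iff)
    also have "\<dots> = (\<Prod>i<n. (\<integral>\<^sup>+ x. q x * indicator (A i) (g x) \<partial>M))"
      by (rule M.product_nn_integral_prod) auto
    also have "\<dots> = (\<Prod>i<n. emeasure ?Q (A i))"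
    proof (intro prod.cong refl)
      fix i assume "i \<in> {..<n}"
      then have [measurable]: "A i \<in> sets N" by simp
      have "emeasure ?Q (A i) = (\<integral>\<^sup>+ x. indicator (A i) x \<partial>?Q)" by simp
      also have "\<dots> = (\<integral>\<^sup>+ x. q x * indicator (A i) (g x) \<partial>M)"
        by (subst nn_integral_distr) (simp_all add: nn_integral_density)
      finally show "(\<integral>\<^sup>+ x. q x * indicator (A i) (g x) \<partial>M) = emeasure ?Q (A i)" ..
    qed
    finally show "emeasure ?N (Pi\<^sub>E {..<n} A) = (\<Prod>i\<in>{..<n}. emeasure ?Q (A i))" .
  qed simp
  then show ?thesis by (simp add: iid_power_def)
qed

lemma PiM_pair_measure:
  fixes M :: "'a measure" and N :: "'b measure"
  assumes M: "sigma_finite_measure M" and N: "sigma_finite_measure N"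
  shows "PiM {..<n} (\<lambda>_::nat. M \<Otimes>\<^sub>M N)
    = distr (PiM {..<n} (\<lambda>_. M) \<Otimes>\<^sub>M PiM {..<n} (\<lambda>_. N)) (PiM {..<n} (\<lambda>_. M \<Otimes>\<^sub>M N)) (\<lambda>(x, y). \<lambda>i\<in>{..<n}. (x i, y i))"
proof -
  interpret M: sigma_finite_measure M by fact
  interpret N: sigma_finite_measure N by fact
  interpret M: product_sigma_finite "\<lambda>_::nat. M" ..
  interpret N: product_sigma_finite "\<lambda>_::nat. N" ..
  interpret MN: pair_sigma_finite M N ..
  interpret MN: product_sigma_finite "\<lambda>_::nat. M \<Otimes>\<^sub>M N" ..
  interpret PM: finite_product_sigma_finite "\<lambda>_::nat. M" "{..<n}" by standard simp
  interpret PN: finite_product_sigma_finite "\<lambda>_::nat. N" "{..<n}" by standard simp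
  let ?zip = "\<lambda>(x, y). \<lambda>i\<in>{..<n}. (x i, y i)"
  let ?D = "distr (PiM {..<n} (\<lambda>_. M) \<Otimes>\<^sub>M PiM {..<n} (\<lambda>_. N)) (PiM {..<n} (\<lambda>_. M \<Otimes>\<^sub>M N)) ?zip"
  have zip [measurable]: "?zip \<in> PiM {..<n} (\<lambda>_. M) \<Otimes>\<^sub>M PiM {..<n} (\<lambda>_. N) \<rightarrow>\<^sub>M PiM {..<n} (\<lambda>_. M \<Otimes>\<^sub>M N)"
    unfolding case_prod_beta by measurable
  have "?D = PiM {..<n} (\<lambda>_. M \<Otimes>\<^sub>M N)"
  proof (rule MN.PiM_eqI)
    fix A :: "nat \<Rightarrow> ('a \<times> 'b) set"
    assume "\<And>i. i \<in> {..<n} \<Longrightarrow> A i \<in> sets (M \<Otimes>\<^sub>M N)"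
    then have A [measurable]: "i < n \<Longrightarrow> A i \<in> sets (M \<Otimes>\<^sub>M N)" for i by simp
    have box: "Pi\<^sub>E {..<n} A \<in> sets (PiM {..<n} (\<lambda>_. M \<Otimes>\<^sub>M N))"
      by (intro sets_PiM_I_finite) auto
    have ind: "indicator (Pi\<^sub>E {..<n} A) (\<lambda>i\<in>{..<n}. (x i, y i)) = (\<Prod>i<n. indicator (A i) (x i, y i) :: ennreal)" for x y
      by (auto simp: indicator_def PiE_iff prod_zero_iff)
    have "emeasure ?D (Pi\<^sub>E {..<n} A) = (\<integral>\<^sup>+ z. indicator (Pi\<^sub>E {..<n} A) z \<partial>?D)"
      using box by simp
    also have "\<dots> = (\<integral>\<^sup>+ w. indicator (Pi\<^sub>E {..<n} A) (?zip w) \<partial>(PiM {..<n} (\<lambda>_. M) \<Otimes>\<^sub>M PiM {..<n} (\<lambda>_. N)))"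
      using box by (subst nn_integral_distr) simp_all
    also have "\<dots> = (\<integral>\<^sup>+ x. \<integral>\<^sup>+ y. indicator (Pi\<^sub>E {..<n} A) (?zip (x, y)) \<partial>PiM {..<n} (\<lambda>_. N) \<partial>PiM {..<n} (\<lambda>_. M))"
      using box by (intro PN.nn_integral_fst[symmetric]) measurable
    also have "\<dots> = (\<integral>\<^sup>+ x. \<integral>\<^sup>+ y. (\<Prod>i<n. indicator (A i) (x i, y i)) \<partial>PiM {..<n} (\<lambda>_. N) \<partial>PiM {..<n} (\<lambda>_. M))"
      by (simp add: ind del: indicator_simps)
    also have "\<dots> = (\<integral>\<^sup>+ x. (\<Prod>i<n. (\<integral>\<^sup>+ y. indicator (A i) (x i, y) \<partial>N)) \<partial>PiM {..<n} (\<lambda>_. M))"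
    proof (intro nn_integral_cong)
      fix x assume "x \<in> space (PiM {..<n} (\<lambda>_. M))"
      then have x: "i < n \<Longrightarrow> x i \<in> space M" for i by (auto simp: space_PiM PiE_iff)
      show "(\<integral>\<^sup>+ y. (\<Prod>i<n. indicator (A i) (x i, y i)) \<partial>PiM {..<n} (\<lambda>_. N)) = (\<Prod>i<n. (\<integral>\<^sup>+ y. indicator (A i) (x i, y) \<partial>N))"
        using x by (intro N.product_nn_integral_prod) auto
    qed
    also have "\<dots> = (\<Prod>i<n. (\<integral>\<^sup>+ x. \<integral>\<^sup>+ y. indicator (A i) (x, y) \<partial>N \<partial>M))"
      by (intro M.product_nn_integral_prod) auto
    also have "\<dots> = (\<Prod>i<n. emeasure (M \<Otimes>\<^sub>M N) (A i))"
      by (intro prod.cong refl N.emeasure_pair_measure[symmetric]) simp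
    finally show "emeasure ?D (Pi\<^sub>E {..<n} A) = (\<Prod>i\<in>{..<n}. emeasure (M \<Otimes>\<^sub>M N) (A i))" .
  qed simp_all
  then show ?thesis ..
qed

text \<open>
  Since \<open>1 - L\<close> integrates to \<open>0\<close>, the indicator of an event may be replaced by the indicator minus
  \<open>1/2\<close>, whose absolute value is \<open>1/2\<close>. The rest is Jensen's inequality for \<open>\<bar>L - 1\<bar>\<close>.
\<close>
lemma tv_dist_density_le:
  assumes "prob_space M" and [measurable]: "L \<in> borel_measurable M"
    and L0: "\<And>x. 0 \<le> L x"
    and sq: "integrable M (\<lambda>x. (L x)\<^sup>2)" and L1: "(\<integral>x. L x \<partial>M) = 1"
  shows "tv_dist M (density M (\<lambda>x. ennreal (L x))) \<le> 1 / 2 * sqrt ((\<integral>x. (L x)\<^sup>2 \<partial>M) - 1)"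
proof -
  interpret prob_space M by fact
  have int: "integrable M L"
    using square_integrable_imp_integrable[OF _ sq] by simp
  define h where "h x = \<bar>L x - 1\<bar>" for x
  have int_h: "integrable M h" "integrable M (\<lambda>x. (h x)\<^sup>2)"
    using int sq by (auto simp: h_def[abs_def] power2_diff intro!: integrable_abs)
  have "(\<integral>x. h x \<partial>M) \<le> sqrt (\<integral>x. (h x)\<^sup>2 \<partial>M)"
    using variance_positive[of h] variance_eq[OF int_h] by (intro real_le_rsqrt) simp
  also have "(\<integral>x. (h x)\<^sup>2 \<partial>M) = (\<integral>x. (L x)\<^sup>2 \<partial>M) - 1"
    using int sq L1 by (simp add: h_def power2_diff prob_space)
  finally have h_le: "(\<integral>x. h x \<partial>M) \<le> sqrt ((\<integral>x. (L x)\<^sup>2 \<partial>M) - 1)" .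
  show ?thesis
    unfolding tv_dist_def
  proof (rule cSUP_least)
    show "sets M \<noteq> {}" by auto
    fix A assume A [measurable]: "A \<in> sets M"
    have intA: "integrable M (\<lambda>x. L x * indicator A x)"
      using int by (rule integrable_real_mult_indicator[OF A])
    have "emeasure (density M (\<lambda>x. ennreal (L x))) A = (\<integral>\<^sup>+ x. ennreal (L x * indicator A x) \<partial>M)"
      by (subst emeasure_density) (auto intro!: nn_integral_cong split: split_indicator)
    also have "\<dots> = ennreal (\<integral>x. L x * indicator A x \<partial>M)"
      by (rule nn_integral_eq_integral[OF intA]) (auto simp: L0)
    finally have "measure (density M (\<lambda>x. ennreal (L x))) A = (\<integral>x. L x * indicator A x \<partial>M)"
      by (simp add: measure_def L0 Bochner_Integration.integral_nonneg)
    moreover have "measure M A = (\<integral>x. indicator A x \<partial>M)" by simp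
    ultimately have "measure M A - measure (density M (\<lambda>x. ennreal (L x))) A
        = (\<integral>x. indicator A x \<partial>M) - (\<integral>x. L x * indicator A x \<partial>M) + 1 / 2 * ((\<integral>x. L x \<partial>M) - 1)"
      using L1 by simp
    also have "\<dots> = (\<integral>x. (indicator A x - L x * indicator A x) + 1 / 2 * (L x - 1) \<partial>M)"
    proof -
      have intI: "integrable M (\<lambda>x. indicator A x - L x * indicator A x)"
        using intA by (intro Bochner_Integration.integrable_diff) (auto simp: less_top[symmetric])
      have intL: "integrable M (\<lambda>x. 1 / 2 * (L x - 1))"
        using int by simp
      show ?thesis
        using int intA by (subst Bochner_Integration.integral_add[OF intI intL])
          (subst Bochner_Integration.integral_diff, auto simp: prob_space less_top[symmetric])
    qed
    also have "\<dots> = (\<integral>x. (1 - L x) * (indicator A x - 1 / 2) \<partial>M)"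
      by (intro Bochner_Integration.integral_cong) (auto simp: algebra_simps diff_divide_distrib)
    finally have "\<bar>measure M A - measure (density M (\<lambda>x. ennreal (L x))) A\<bar> = \<bar>\<integral>x. (1 - L x) * (indicator A x - 1 / 2) \<partial>M\<bar>"
      by simp
    also have "\<dots> \<le> (\<integral>x. \<bar>(1 - L x) * (indicator A x - 1 / 2)\<bar> \<partial>M)"
      by (rule integral_abs_bound)
    also have "\<dots> = (\<integral>x. 1 / 2 * h x \<partial>M)"
      by (intro Bochner_Integration.integral_cong) (auto simp: h_def abs_mult split: split_indicator)
    also have "\<dots> \<le> 1 / 2 * sqrt ((\<integral>x. (L x)\<^sup>2 \<partial>M) - 1)"
      using h_le by simp
    finally show "\<bar>measure M A - measure (density M (\<lambda>x. ennreal (L x))) A\<bar> \<le> 1 / 2 * sqrt ((\<integral>x. (L x)\<^sup>2 \<partial>M) - 1)" .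
  qed
qed

definition zip_upto :: "nat \<Rightarrow> (nat \<Rightarrow> 'a) \<Rightarrow> (nat \<Rightarrow> 'b) \<Rightarrow> nat \<Rightarrow> 'a \<times> 'b" where
  "zip_upto n x y = (\<lambda>i\<in>{..<n}. (x i, y i))"

lemma measurable_zip_upto [measurable (raw)]:
  fixes x :: "'c \<Rightarrow> nat \<Rightarrow> 'a::second_countable_topology" and y :: "'c \<Rightarrow> nat \<Rightarrow> 'b::second_countable_topology"
  assumes "\<And>i. i < n \<Longrightarrow> (\<lambda>w. x w i) \<in> borel_measurable N" "\<And>i. i < n \<Longrightarrow> (\<lambda>w. y w i) \<in> borel_measurable N"
  shows "(\<lambda>w. zip_upto n (x w) (y w)) \<in> N \<rightarrow>\<^sub>M PiM {..<n} (\<lambda>_. borel)"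
  unfolding zip_upto_def borel_prod[symmetric] using assms by (intro measurable_restrict measurable_Pair) auto

text \<open>
  The sample is split into its designs and its responses, so that the responses can be integrated for
  fixed designs.
\<close>
lemma nn_integral_iid_power_density:
  fixes p :: "'a::euclidean_space \<times> 'b::euclidean_space \<Rightarrow> ennreal"
  assumes [measurable]: "p \<in> borel_measurable borel" and prob: "prob_space (density lborel p)"
    and [measurable]: "f \<in> borel_measurable (PiM {..<n} (\<lambda>_. borel))"
  shows "(\<integral>\<^sup>+ z. f z \<partial>iid_power n (density lborel p))
    = (\<integral>\<^sup>+ x. \<integral>\<^sup>+ y. f (zip_upto n x y) * (\<Prod>i<n. p (x i, y i)) \<partial>PiM {..<n} (\<lambda>_. lborel) \<partial>PiM {..<n} (\<lambda>_. lborel))"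
proof -
  interpret product_sigma_finite "\<lambda>_::nat. lborel :: 'b measure" ..
  interpret PN: finite_product_sigma_finite "\<lambda>_::nat. lborel :: 'b measure" "{..<n}" by standard simp
  define F where "F z = (\<Prod>i<n. p (z i)) * f z" for z
  have [measurable]: "F \<in> borel_measurable (PiM {..<n} (\<lambda>_. lborel))"
    unfolding F_def by (intro borel_measurable_times_ennreal borel_measurable_prod_ennreal) measurable
  have distr: "distr (density lborel p) borel (\<lambda>x. x) = density lborel p"
    by (rule distr_id2) simp
  have "iid_power n (density lborel p)
      = distr (density (PiM {..<n} (\<lambda>_. lborel)) (\<lambda>x. \<Prod>i<n. p (x i))) (PiM {..<n} (\<lambda>_. borel)) (\<lambda>x. \<lambda>i\<in>{..<n}. x i)"
    using iid_power_distr_density[of lborel p "\<lambda>x. x" borel n] prob lborel.sigma_finite_measure_axioms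
    by (simp add: distr)
  then have "(\<integral>\<^sup>+ z. f z \<partial>iid_power n (density lborel p))
      = (\<integral>\<^sup>+ z. (\<Prod>i<n. p (z i)) * f (\<lambda>i\<in>{..<n}. z i) \<partial>PiM {..<n} (\<lambda>_. lborel))"
    by (simp add: nn_integral_distr nn_integral_density)
  also have "\<dots> = (\<integral>\<^sup>+ z. F z \<partial>PiM {..<n} (\<lambda>_. lborel))"
    by (intro nn_integral_cong) (auto simp: F_def space_PiM extensional_restrict PiE_def)
  also have "\<dots> = (\<integral>\<^sup>+ w. F (case w of (x, y) \<Rightarrow> \<lambda>i\<in>{..<n}. (x i, y i)) \<partial>(PiM {..<n} (\<lambda>_. lborel) \<Otimes>\<^sub>M PiM {..<n} (\<lambda>_. lborel)))"
    unfolding lborel_prod[symmetric]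
    by (subst PiM_pair_measure[OF lborel.sigma_finite_measure_axioms lborel.sigma_finite_measure_axioms], subst nn_integral_distr)
      (simp_all add: lborel_prod case_prod_beta del: lborel_prod, simp_all add: lborel_prod)
  also have "\<dots> = (\<integral>\<^sup>+ w. F (case w of (x, y) \<Rightarrow> zip_upto n x y) \<partial>(PiM {..<n} (\<lambda>_. lborel) \<Otimes>\<^sub>M PiM {..<n} (\<lambda>_. lborel)))"
    by (simp add: zip_upto_def)
  also have "\<dots> = (\<integral>\<^sup>+ x. \<integral>\<^sup>+ y. F (zip_upto n x y) \<partial>PiM {..<n} (\<lambda>_. lborel) \<partial>PiM {..<n} (\<lambda>_. lborel))"
    by (subst PN.nn_integral_fst[symmetric]) (simp_all add: case_prod_beta)
  also have "\<dots> = (\<integral>\<^sup>+ x. \<integral>\<^sup>+ y. f (zip_upto n x y) * (\<Prod>i<n. p (x i, y i)) \<partial>PiM {..<n} (\<lambda>_. lborel) \<partial>PiM {..<n} (\<lambda>_. lborel))"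
    by (intro nn_integral_cong) (auto simp: F_def zip_upto_def mult.commute intro!: arg_cong2[where f="(*)"] prod.cong)
  finally show ?thesis .
qed

section \<open>The mixture of linear models and its likelihood ratio\<close>

context gaussian_form
begin

text \<open>
  The joint density of the forms \<open>R * B (x j) b\<close>, evaluated at the responses and multiplied by
  the constant \<open>(sqrt (2 * pi) * R) ^ n\<close>. It is the likelihood ratio of the mixture up to normalisation.
\<close>
definition ratio :: "real \<Rightarrow> nat \<Rightarrow> (nat \<Rightarrow> 'a \<times> real) \<Rightarrow> real" where
  "ratio R n z = (\<Prod>j<n. exp (- (whiten (fst \<circ> z) (snd \<circ> z) j)\<^sup>2 / (2 * R\<^sup>2 * B (gs (fst \<circ> z) j) (gs (fst \<circ> z) j)))
     / sqrt (B (gs (fst \<circ> z) j) (gs (fst \<circ> z) j)))"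

lemma measurable_ratio [measurable]: "ratio R n \<in> borel_measurable (PiM {..<n} (\<lambda>_. borel))"
proof -
  have component: "(\<lambda>z. z i) \<in> PiM {..<n} (\<lambda>_. borel) \<rightarrow>\<^sub>M (borel :: ('a \<times> real) measure)" if "i < n" for i
    using measurable_component_singleton[of i "{..<n}" "\<lambda>_. borel"] that by simp
  have "(fst :: 'a \<times> real \<Rightarrow> 'a) \<in> borel_measurable borel" "(snd :: 'a \<times> real \<Rightarrow> real) \<in> borel_measurable borel"
    by (intro borel_measurable_continuous_onI continuous_on_fst continuous_on_snd continuous_on_id)+
  note fst = measurable_compose[OF component this(1)] and snd = measurable_compose[OF component this(2)]
  show ?thesis
    unfolding ratio_def comp_def
  proof (intro borel_measurable_prod)
    fix j assume "j \<in> {..<n}"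
    then have [measurable]: "(\<lambda>z. gs (\<lambda>i. fst (z i)) j) \<in> borel_measurable (PiM {..<n} (\<lambda>_. borel :: ('a \<times> real) measure))"
      "(\<lambda>z. whiten (\<lambda>i. fst (z i)) (\<lambda>i. snd (z i)) j) \<in> borel_measurable (PiM {..<n} (\<lambda>_. borel :: ('a \<times> real) measure))"
      by (auto intro!: measurable_gs measurable_whiten fst snd)
    show "(\<lambda>z. exp (- (whiten (\<lambda>i. fst (z i)) (\<lambda>i. snd (z i)) j)\<^sup>2 / (2 * R\<^sup>2 * B (gs (\<lambda>i. fst (z i)) j) (gs (\<lambda>i. fst (z i)) j)))
        / sqrt (B (gs (\<lambda>i. fst (z i)) j) (gs (\<lambda>i. fst (z i)) j))) \<in> borel_measurable (PiM {..<n} (\<lambda>_. borel :: ('a \<times> real) measure))"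
      by measurable
  qed
qed

lemma ratio_nonneg: "0 \<le> ratio R n z"
  unfolding ratio_def by (intro prod_nonneg) (simp add: form_nonneg)

lemma ratio_zip_upto:
  "ratio R n (zip_upto n x y) = (\<Prod>j<n. exp (- (whiten x y j)\<^sup>2 / (2 * R\<^sup>2 * B (gs x j) (gs x j))) / sqrt (B (gs x j) (gs x j)))"
proof -
  have "gs (fst \<circ> zip_upto n x y) j = gs x j" "whiten (fst \<circ> zip_upto n x y) (snd \<circ> zip_upto n x y) j = whiten x y j" if "j < n" for j
    using that by (auto simp: zip_upto_def intro!: gs_cong whiten_cong)
  then show ?thesis by (simp add: ratio_def)
qed

lemma normal_density_scaled:
  assumes "0 < R" "0 < q"
  shows "normal_density 0 (R * sqrt q) w = (1 / (sqrt (2 * pi) * R)) * (exp (- w\<^sup>2 / (2 * R\<^sup>2 * q)) / sqrt q)"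
  using assms by (simp add: normal_density_def power_mult_distrib real_sqrt_mult mult.assoc)

text \<open>
  Exchange the integrals and use, for almost every \<open>x\<close>, the density of the responses under random \<open>b\<close>.
  On the left the responses are a function of \<open>x\<close> and \<open>b\<close>; on the right they are free and the
  exact linear relation has become a density with respect to the true law of the sample.
\<close>
lemma linear_model_density:
  fixes p :: "'a \<times> real \<Rightarrow> ennreal"
  assumes [measurable]: "p \<in> borel_measurable borel" and prob: "prob_space (density lborel p)"
    and f [measurable]: "f \<in> borel_measurable (PiM {..<n} (\<lambda>_. borel))"
    and R: "0 < R" and n: "n \<le> DIM('a)"
  shows "(\<integral>\<^sup>+ b. \<integral>\<^sup>+ x. f (zip_upto n x (\<lambda>i. R * B (x i) b)) * (\<Prod>i<n. p (x i, R * B (x i) b)) \<partial>PiM {..<n} (\<lambda>_. lborel) \<partial>\<gamma>)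
    = ennreal ((1 / (sqrt (2 * pi) * R)) ^ n) * (\<integral>\<^sup>+ z. f z * ennreal (ratio R n z) \<partial>iid_power n (density lborel p))"
proof -
  interpret \<gamma>: prob_space \<gamma> by (rule prob_space_\<gamma>)
  interpret PM: finite_product_sigma_finite "\<lambda>_::nat. lborel :: 'a measure" "{..<n}" by standard simp
  interpret PR: finite_product_sigma_finite "\<lambda>_::nat. lborel :: real measure" "{..<n}" by standard simp
  interpret pair_sigma_finite \<gamma> "PiM {..<n} (\<lambda>_::nat. lborel :: 'a measure)" ..
  let ?K = "(1 / (sqrt (2 * pi) * R)) ^ n"
  define F where "F z = f z * (\<Prod>i<n. p (z i))" for z
  have F [measurable]: "F \<in> borel_measurable (PiM {..<n} (\<lambda>_. borel))"
    unfolding F_def by (intro borel_measurable_times_ennreal borel_measurable_prod_ennreal) measurable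
  have F_zip: "F (zip_upto n x y) = f (zip_upto n x y) * (\<Prod>i<n. p (x i, y i))" for x y
    by (auto simp: F_def zip_upto_def intro!: arg_cong2[where f="(*)"] prod.cong)
  have inner: "(\<integral>\<^sup>+ b. F (zip_upto n x (\<lambda>i. R * B (x i) b)) \<partial>\<gamma>)
      = ennreal ?K * (\<integral>\<^sup>+ y. F (zip_upto n x y) * ennreal (ratio R n (zip_upto n x y)) \<partial>PiM {..<n} (\<lambda>_. lborel))"
    if nz: "\<forall>j<n. gs x j \<noteq> 0" for x
  proof -
    have "(\<integral>\<^sup>+ b. F (zip_upto n x (\<lambda>i. R * B (x i) b)) \<partial>\<gamma>)
        = (\<integral>\<^sup>+ b. F (zip_upto n x (\<lambda>i\<in>{..<n}. R * B (x i) b)) \<partial>\<gamma>)"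
      by (intro nn_integral_cong arg_cong[where f=F]) (auto simp: zip_upto_def)
    also have "\<dots> = (\<integral>\<^sup>+ y. F (zip_upto n x y) * (\<Prod>j<n. ennreal (normal_density 0 (R * sqrt (B (gs x j) (gs x j))) (whiten x y j)))
        \<partial>PiM {..<n} (\<lambda>_. lborel))"
      using nz R by (intro nn_integral_forms) auto
    also have "\<dots> = (\<integral>\<^sup>+ y. ennreal ?K * (F (zip_upto n x y) * ennreal (ratio R n (zip_upto n x y))) \<partial>PiM {..<n} (\<lambda>_. lborel))"
    proof (intro nn_integral_cong)
      fix y
      have "(\<Prod>j<n. normal_density 0 (R * sqrt (B (gs x j) (gs x j))) (whiten x y j)) = ?K * ratio R n (zip_upto n x y)"
      proof -
        have "(\<Prod>j<n. normal_density 0 (R * sqrt (B (gs x j) (gs x j))) (whiten x y j))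
          = (\<Prod>j<n. (1 / (sqrt (2 * pi) * R)) * (exp (- (whiten x y j)\<^sup>2 / (2 * R\<^sup>2 * B (gs x j) (gs x j))) / sqrt (B (gs x j) (gs x j))))"
          using nz pos R by (intro prod.cong refl normal_density_scaled) auto
        then show ?thesis
          unfolding ratio_zip_upto prod.distrib by simp
      qed
      then have "(\<Prod>j<n. ennreal (normal_density 0 (R * sqrt (B (gs x j) (gs x j))) (whiten x y j))) = ennreal ?K * ennreal (ratio R n (zip_upto n x y))"
        using R by (subst prod_ennreal) (auto simp: ennreal_mult ratio_nonneg)
      then show "F (zip_upto n x y) * (\<Prod>j<n. ennreal (normal_density 0 (R * sqrt (B (gs x j) (gs x j))) (whiten x y j)))
          = ennreal ?K * (F (zip_upto n x y) * ennreal (ratio R n (zip_upto n x y)))"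
        by (simp only: mult.left_commute)
    qed
    also have "\<dots> = ennreal ?K * (\<integral>\<^sup>+ y. F (zip_upto n x y) * ennreal (ratio R n (zip_upto n x y)) \<partial>PiM {..<n} (\<lambda>_. lborel))"
      by (rule nn_integral_cmult) measurable
    finally show ?thesis .
  qed
  have "(\<integral>\<^sup>+ b. \<integral>\<^sup>+ x. f (zip_upto n x (\<lambda>i. R * B (x i) b)) * (\<Prod>i<n. p (x i, R * B (x i) b)) \<partial>PiM {..<n} (\<lambda>_. lborel) \<partial>\<gamma>)
      = (\<integral>\<^sup>+ b. \<integral>\<^sup>+ x. F (zip_upto n x (\<lambda>i. R * B (x i) b)) \<partial>PiM {..<n} (\<lambda>_. lborel) \<partial>\<gamma>)"
    by (simp add: F_zip)
  also have "\<dots> = (\<integral>\<^sup>+ x. \<integral>\<^sup>+ b. F (zip_upto n x (\<lambda>i. R * B (x i) b)) \<partial>\<gamma> \<partial>PiM {..<n} (\<lambda>_. lborel))"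
    by (rule Fubini'[symmetric]) measurable
  also have "\<dots> = (\<integral>\<^sup>+ x. ennreal ?K * (\<integral>\<^sup>+ y. F (zip_upto n x y) * ennreal (ratio R n (zip_upto n x y)) \<partial>PiM {..<n} (\<lambda>_. lborel)) \<partial>PiM {..<n} (\<lambda>_. lborel))"
  proof (rule nn_integral_cong_AE)
    have "AE x in PiM {..<n} (\<lambda>_. lborel). \<forall>j<n. gs x j \<noteq> 0"
      using n by (intro AE_gs_nonzero lborel.sigma_finite_measure_axioms) auto
    then show "AE x in PiM {..<n} (\<lambda>_. lborel). (\<integral>\<^sup>+ b. F (zip_upto n x (\<lambda>i. R * B (x i) b)) \<partial>\<gamma>)
      = ennreal ?K * (\<integral>\<^sup>+ y. F (zip_upto n x y) * ennreal (ratio R n (zip_upto n x y)) \<partial>PiM {..<n} (\<lambda>_. lborel))"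
      by eventually_elim (rule inner)
  qed
  also have "\<dots> = ennreal ?K * (\<integral>\<^sup>+ x. \<integral>\<^sup>+ y. F (zip_upto n x y) * ennreal (ratio R n (zip_upto n x y)) \<partial>PiM {..<n} (\<lambda>_. lborel) \<partial>PiM {..<n} (\<lambda>_. lborel))"
    by (rule nn_integral_cmult) measurable
  also have "\<dots> = ennreal ?K * (\<integral>\<^sup>+ z. f z * ennreal (ratio R n z) \<partial>iid_power n (density lborel p))"
    by (subst nn_integral_iid_power_density[OF _ prob]) (simp_all add: F_zip mult_ac)
  finally show ?thesis .
qed

end

locale gaussian_design = gaussian_form B \<kappa>
  for B :: "real^'d \<Rightarrow> real^'d \<Rightarrow> real" and \<kappa> :: real +
  fixes p :: "(real^'d) \<times> real \<Rightarrow> ennreal" and n :: nat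
  assumes p_measurable [measurable]: "p \<in> borel_measurable borel"
    and prob_P: "prob_space (density lborel p)"
    and marginal: "distr (density lborel p) borel fst = \<gamma>"
    and n_ge: "1 \<le> n" and n_le: "n + 2 \<le> CARD('d)"
begin

abbreviation "Pn \<equiv> iid_power n (density lborel p)"

definition weight :: "real \<Rightarrow> real^'d \<Rightarrow> ennreal" where
  "weight R b = (\<integral>\<^sup>+ x. p (x, R * B x b) \<partial>lborel)"

text \<open>
  The joint density restricted to the graph of the regression function and normalised. The point mass
  at the origin is a default for the coefficients where this is impossible; they have prior mass \<open>0\<close>.
\<close>
definition model :: "real \<Rightarrow> real^'d \<Rightarrow> ((real^'d) \<times> real) measure" where
  "model R b = (if 0 < weight R b \<and> weight R b < \<infinity>
     then distr (density lborel (\<lambda>x. p (x, R * B x b) / weight R b)) borel (\<lambda>x. (x, R * B x b))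
     else return borel (0, 0))"

lemma measurable_graph [measurable]: "(\<lambda>x. (x, R * B x b)) \<in> borel \<rightarrow>\<^sub>M borel"
  unfolding borel_prod[symmetric] by measurable

lemma measurable_graph_pair [measurable]: "(\<lambda>(b, x). (x, R * B x b)) \<in> borel \<Otimes>\<^sub>M borel \<rightarrow>\<^sub>M borel"
  unfolding borel_prod[symmetric] by measurable

lemma measurable_weight [measurable]: "weight R \<in> borel_measurable borel"
proof -
  have "(\<lambda>(b, x). p (x, R * B x b)) \<in> borel_measurable (borel \<Otimes>\<^sub>M lborel)"
    using measurable_compose[OF measurable_graph_pair p_measurable] by (simp add: case_prod_beta)
  then show ?thesis unfolding weight_def by measurable
qed

lemma sets_model [simp]: "sets (model R b) = sets borel"
  by (simp add: model_def)

lemma emeasure_model: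
  assumes [measurable]: "A \<in> sets borel"
  shows "emeasure (model R b) A = (if 0 < weight R b \<and> weight R b < \<infinity>
    then (\<integral>\<^sup>+ x. p (x, R * B x b) * indicator A (x, R * B x b) \<partial>lborel) / weight R b
    else indicator A (0, 0))"
proof (cases "0 < weight R b \<and> weight R b < \<infinity>")
  case True
  have "emeasure (model R b) A = (\<integral>\<^sup>+ z. indicator A z \<partial>model R b)"
    by simp
  also have "\<dots> = (\<integral>\<^sup>+ x. p (x, R * B x b) / weight R b * indicator A (x, R * B x b) \<partial>lborel)"
    unfolding model_def if_P[OF True] by (subst nn_integral_distr) (simp_all add: nn_integral_density)
  also have "\<dots> = (\<integral>\<^sup>+ x. p (x, R * B x b) * indicator A (x, R * B x b) / weight R b \<partial>lborel)"
    by (intro nn_integral_cong) (auto simp: divide_ennreal_def mult_ac)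
  also have "\<dots> = (\<integral>\<^sup>+ x. p (x, R * B x b) * indicator A (x, R * B x b) \<partial>lborel) / weight R b"
    by (rule nn_integral_divide) measurable
  finally show ?thesis using True by simp
qed (auto simp: model_def)

lemma prob_space_model: "prob_space (model R b)"
proof (rule prob_spaceI)
  have "space (model R b) = UNIV" by (simp add: model_def)
  then show "emeasure (model R b) (space (model R b)) = 1"
    by (auto simp: emeasure_model weight_def[symmetric] ennreal_divide_self less_top[symmetric])
qed

text \<open>The coefficient vector \<open>\<beta>\<close> represents the linear functional \<open>x \<mapsto> R * B x b\<close> by the inner product.\<close>
lemma model_in_Q_lin: "model R b \<in> Q_lin"
proof -
  have "\<exists>\<beta>. AE (x, y) in model R b. y = x \<bullet> \<beta>"
  proof (cases "0 < weight R b \<and> weight R b < \<infinity>")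
    case True
    define \<beta> where "\<beta> = adjoint (\<lambda>x. R * B x b) 1"
    have "linear (\<lambda>x. R * B x b)"
      by (rule linearI) (simp_all add: add_left scaleR_left algebra_simps)
    then have graph: "R * B x b = x \<bullet> \<beta>" for x
      using adjoint_works[of "\<lambda>x. R * B x b" x 1] by (simp only: \<beta>_def inner_real_def mult_1_right)
    have "closed {z. snd z = fst z \<bullet> \<beta>}"
      by (intro closed_Collect_eq continuous_intros)
    then have "{z \<in> space borel. case z of (x, y) \<Rightarrow> y = x \<bullet> \<beta>} \<in> sets borel"
      by (simp add: case_prod_beta borel_closed)
    then have "AE (x, y) in model R b. y = x \<bullet> \<beta>"
      unfolding model_def if_P[OF True] by (subst AE_distr_iff) (simp_all add: graph)
    then show ?thesis by blast
  next
    case False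
    have "closed {z. snd z = fst z \<bullet> (0 :: real^'d)}"
      by (intro closed_Collect_eq continuous_intros)
    then have "{z \<in> space borel. case z of (x, y) \<Rightarrow> y = x \<bullet> (0 :: real^'d)} \<in> sets borel"
      by (simp add: case_prod_beta borel_closed)
    then have "AE (x, y) in model R b. y = x \<bullet> (0 :: real^'d)"
      unfolding model_def if_not_P[OF False] by (subst AE_return) (simp_all add: pred_def)
    then show ?thesis by blast
  qed
  then show ?thesis using prob_space_model by (simp add: Q_lin_def)
qed

lemma measurable_model: "model R \<in> \<gamma> \<rightarrow>\<^sub>M restrict_space (prob_algebra borel) Q_lin"
proof (intro measurable_restrict_space2 measurable_prob_algebraI measurable_subprob_algebra)
  fix A :: "((real^'d) \<times> real) set" assume A [measurable]: "A \<in> sets borel"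
  have "(\<lambda>z. p z * indicator A z) \<in> borel_measurable borel" by measurable
  from measurable_compose[OF measurable_graph_pair this]
  have [measurable]: "(\<lambda>(b, x). p (x, R * B x b) * indicator A (x, R * B x b)) \<in> borel_measurable (borel \<Otimes>\<^sub>M lborel)"
    by (simp add: case_prod_beta)
  show "(\<lambda>b. emeasure (model R b) A) \<in> borel_measurable \<gamma>"
    unfolding emeasure_model[OF A] by measurable
qed (auto simp: prob_space_model model_in_Q_lin intro: prob_space_imp_subprob_space)

lemma weight_power:
  "(\<integral>\<^sup>+ x. (\<Prod>i<n. p (x i, R * B (x i) b)) \<partial>PiM {..<n} (\<lambda>_. lborel)) = weight R b ^ n"
proof -
  interpret product_sigma_finite "\<lambda>_::nat. lborel :: (real^'d) measure" ..
  have "(\<integral>\<^sup>+ x. (\<Prod>i<n. p (x i, R * B (x i) b)) \<partial>PiM {..<n} (\<lambda>_. lborel)) = (\<Prod>i<n. weight R b)"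
    unfolding weight_def by (rule product_nn_integral_prod) auto
  then show ?thesis by simp
qed

text \<open>
  Multiplying by \<open>weight R b ^ n\<close> cancels the normalisation of \<open>model R b\<close>. If the weight is \<open>0\<close>, both
  sides vanish because \<open>n \<ge> 1\<close>.
\<close>
lemma iid_power_model:
  assumes A [measurable]: "A \<in> sets (PiM {..<n} (\<lambda>_. borel))" and fin: "weight R b < \<infinity>"
  shows "weight R b ^ n * emeasure (iid_power n (model R b)) A
    = (\<integral>\<^sup>+ x. indicator A (zip_upto n x (\<lambda>i. R * B (x i) b)) * (\<Prod>i<n. p (x i, R * B (x i) b)) \<partial>PiM {..<n} (\<lambda>_. lborel))"
    (is "_ = ?rhs")
proof (cases "weight R b = 0")
  case True
  have "?rhs \<le> (\<integral>\<^sup>+ x. (\<Prod>i<n. p (x i, R * B (x i) b)) \<partial>PiM {..<n} (\<lambda>_. lborel))"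
    by (intro nn_integral_mono) (auto split: split_indicator)
  then show ?thesis using True n_ge by (simp add: weight_power power_0_left)
next
  case False
  let ?w = "weight R b"
  let ?q = "\<lambda>x. p (x, R * B x b) / ?w"
  have w: "?w \<noteq> 0" "?w \<noteq> \<top>" using False fin by auto
  have model: "model R b = distr (density lborel ?q) borel (\<lambda>x. (x, R * B x b))"
    using w by (simp add: model_def less_top zero_less_iff_neq_zero)
  have "emeasure (iid_power n (model R b)) A = (\<integral>\<^sup>+ z. indicator A z \<partial>iid_power n (model R b))"
    by (simp add: iid_power_def sets_PiM_cong[OF refl sets_model] cong: sets_PiM_cong)
  also have "\<dots> = (\<integral>\<^sup>+ x. (\<Prod>i<n. ?q (x i)) * indicator A (zip_upto n x (\<lambda>i. R * B (x i) b)) \<partial>PiM {..<n} (\<lambda>_. lborel))"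
  proof -
    have eq: "iid_power n (model R b) = distr (density (PiM {..<n} (\<lambda>_. lborel)) (\<lambda>x. \<Prod>i<n. ?q (x i)))
        (PiM {..<n} (\<lambda>_. borel)) (\<lambda>x. zip_upto n x (\<lambda>i. R * B (x i) b))"
      using prob_space_model[of R b] unfolding model zip_upto_def
      by (intro iid_power_distr_density lborel.sigma_finite_measure_axioms) auto
    show ?thesis
      unfolding eq by (subst nn_integral_distr) (simp_all add: nn_integral_density)
  qed
  finally have "?w ^ n * emeasure (iid_power n (model R b)) A
      = (\<integral>\<^sup>+ x. ?w ^ n * ((\<Prod>i<n. ?q (x i)) * indicator A (zip_upto n x (\<lambda>i. R * B (x i) b))) \<partial>PiM {..<n} (\<lambda>_. lborel))"
    by (simp add: nn_integral_cmult)
  also have "\<dots> = ?rhs"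
  proof (intro nn_integral_cong)
    fix x
    have "?w ^ n * (\<Prod>i<n. ?q (x i)) = (\<Prod>i<n. ?w * ?q (x i))"
      by (simp add: prod.distrib)
    also have "\<dots> = (\<Prod>i<n. p (x i, R * B (x i) b))"
      using w by (intro prod.cong refl) (simp add: ennreal_times_divide mult.commute[of ?w] ennreal_mult_divide_eq)
    finally show "?w ^ n * ((\<Prod>i<n. ?q (x i)) * indicator A (zip_upto n x (\<lambda>i. R * B (x i) b)))
        = indicator A (zip_upto n x (\<lambda>i. R * B (x i) b)) * (\<Prod>i<n. p (x i, R * B (x i) b))"
      by (simp only: mult.assoc[symmetric]) (rule mult.commute)
  qed
  finally show ?thesis .
qed

lemma prob_space_Pn: "prob_space Pn"
  unfolding iid_power_def by (intro prob_space_PiM prob_P)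

lemma sets_Pn [measurable_cong, simp]: "sets Pn = sets (PiM {..<n} (\<lambda>_. borel))"
  unfolding iid_power_def by (intro sets_PiM_cong) auto

text \<open>
  The prior has density \<open>weight R b ^ n / Z\<close> with respect to \<open>\<gamma>\<close>; the power in the prior is chosen to
  cancel the normalisations of the \<open>n\<close> observations.
\<close>
lemma density_ratio_in_mixtures:
  assumes R: "0 < R" and E: "E = (\<integral>\<^sup>+ z. ennreal (ratio R n z) \<partial>Pn)" "0 < E" "E < \<infinity>"
  shows "density Pn (\<lambda>z. ennreal (ratio R n z) / E) \<in> mixtures_lin n"
proof -
  define K where "K = ennreal ((1 / (sqrt (2 * pi) * R)) ^ n)"
  define Z where "Z = K * E"
  have K: "K \<noteq> 0" "K \<noteq> \<top>" using R by (auto simp: K_def)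
  have Z: "Z \<noteq> 0" "Z \<noteq> \<top>" using K E by (auto simp: Z_def ennreal_mult_eq_top_iff)
  have linear_model: "(\<integral>\<^sup>+ b. \<integral>\<^sup>+ x. f (zip_upto n x (\<lambda>i. R * B (x i) b)) * (\<Prod>i<n. p (x i, R * B (x i) b)) \<partial>PiM {..<n} (\<lambda>_. lborel) \<partial>\<gamma>)
      = K * (\<integral>\<^sup>+ z. f z * ennreal (ratio R n z) \<partial>Pn)"
    if "f \<in> borel_measurable (PiM {..<n} (\<lambda>_. borel))" for f
    unfolding K_def using n_le that by (intro linear_model_density prob_P R) auto
  have weight_Z: "(\<integral>\<^sup>+ b. weight R b ^ n \<partial>\<gamma>) = Z"
    using linear_model[of "\<lambda>_. 1"] by (simp add: weight_power Z_def E)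
  define \<nu>0 where "\<nu>0 = density \<gamma> (\<lambda>b. weight R b ^ n / Z)"
  define \<nu> where "\<nu> = distr \<nu>0 (restrict_space (prob_algebra borel) Q_lin) (model R)"
  have model_meas [measurable]: "model R \<in> \<nu>0 \<rightarrow>\<^sub>M restrict_space (prob_algebra borel) Q_lin"
    using measurable_model by (simp add: \<nu>0_def cong: measurable_cong_sets)
  have "prob_space \<nu>0"
  proof (rule prob_spaceI)
    show "emeasure \<nu>0 (space \<nu>0) = 1"
      using Z by (simp add: \<nu>0_def emeasure_density nn_integral_divide weight_Z ennreal_divide_self less_top)
  qed
  then have "prob_space \<nu>"
    unfolding \<nu>_def by (rule prob_space.prob_space_distr) (rule model_meas)
  then have \<nu>: "\<nu> \<in> space (prob_algebra (restrict_space (prob_algebra borel) Q_lin))"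
    by (simp add: space_prob_algebra \<nu>_def)
  have "\<nu> \<bind> iid_power n = density Pn (\<lambda>z. ennreal (ratio R n z) / E)"
  proof (rule measure_eqI)
    have iid: "iid_power n \<in> restrict_space (prob_algebra borel) Q_lin \<rightarrow>\<^sub>M prob_algebra (PiM {..<n} (\<lambda>_. borel))"
      by (rule measurable_restrict_space1[OF measurable_iid_power])
    have sets_bind: "sets (\<nu> \<bind> iid_power n) = sets (PiM {..<n} (\<lambda>_. borel))"
      by (rule sets_bind'[OF \<nu> iid])
    then show "sets (\<nu> \<bind> iid_power n) = sets (density Pn (\<lambda>z. ennreal (ratio R n z) / E))"
      by simp
    fix A assume "A \<in> sets (\<nu> \<bind> iid_power n)"
    then have A [measurable]: "A \<in> sets (PiM {..<n} (\<lambda>_. borel))" by (simp add: sets_bind)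
    have ev: "(\<lambda>Q. emeasure (iid_power n Q) A) \<in> borel_measurable (restrict_space (prob_algebra borel) Q_lin)"
      by (rule measurable_compose[OF measurable_prob_algebraD[OF iid] measurable_emeasure_subprob_algebra[OF A]])
    \<comment> \<open>Infinite weights are null because the total mass \<open>Z\<close> is finite.\<close>
    have fin: "AE b in \<gamma>. weight R b < \<infinity>"
    proof -
      have "AE b in \<gamma>. weight R b ^ n \<noteq> \<infinity>"
        using Z by (intro nn_integral_PInf_AE) (auto simp: weight_Z)
      then show ?thesis
        by eventually_elim (use n_ge in \<open>auto simp: power_eq_top_ennreal less_top[symmetric]\<close>)
    qed
    have "emeasure (\<nu> \<bind> iid_power n) A = (\<integral>\<^sup>+ Q. emeasure (iid_power n Q) A \<partial>\<nu>)"
      by (rule emeasure_mixture[OF \<nu> A])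
    also have "\<dots> = (\<integral>\<^sup>+ b. emeasure (iid_power n (model R b)) A \<partial>\<nu>0)"
      unfolding \<nu>_def by (rule nn_integral_distr[OF model_meas]) (use ev in simp)
    also have "\<dots> = (\<integral>\<^sup>+ b. weight R b ^ n / Z * emeasure (iid_power n (model R b)) A \<partial>\<gamma>)"
      unfolding \<nu>0_def by (rule nn_integral_density[OF _ measurable_compose[OF measurable_model ev]]) measurable
    also have "\<dots> = (\<integral>\<^sup>+ b. (\<integral>\<^sup>+ x. indicator A (zip_upto n x (\<lambda>i. R * B (x i) b)) * (\<Prod>i<n. p (x i, R * B (x i) b))
        \<partial>PiM {..<n} (\<lambda>_. lborel)) / Z \<partial>\<gamma>)"
    proof (rule nn_integral_cong_AE)
      from fin show "AE b in \<gamma>. weight R b ^ n / Z * emeasure (iid_power n (model R b)) A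
          = (\<integral>\<^sup>+ x. indicator A (zip_upto n x (\<lambda>i. R * B (x i) b)) * (\<Prod>i<n. p (x i, R * B (x i) b)) \<partial>PiM {..<n} (\<lambda>_. lborel)) / Z"
        by eventually_elim (simp add: iid_power_model[OF A, symmetric] divide_ennreal_def mult_ac)
    qed
    also have "\<dots> = (\<integral>\<^sup>+ b. \<integral>\<^sup>+ x. indicator A (zip_upto n x (\<lambda>i. R * B (x i) b)) * (\<Prod>i<n. p (x i, R * B (x i) b))
        \<partial>PiM {..<n} (\<lambda>_. lborel) \<partial>\<gamma>) / Z"
    proof (rule nn_integral_divide)
      interpret finite_product_sigma_finite "\<lambda>_::nat. lborel :: (real^'d) measure" "{..<n}" by standard simp
      have "(\<lambda>z. indicator A z * (\<Prod>i<n. p (z i))) \<in> borel_measurable (PiM {..<n} (\<lambda>_. borel))"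
        by (intro borel_measurable_times_ennreal borel_measurable_prod_ennreal) measurable
      then have "(\<lambda>(b, x). indicator A (zip_upto n x (\<lambda>i. R * B (x i) b)) * (\<Prod>i<n. p (zip_upto n x (\<lambda>i. R * B (x i) b) i)))
          \<in> borel_measurable (\<gamma> \<Otimes>\<^sub>M PiM {..<n} (\<lambda>_. lborel))"
        unfolding case_prod_beta by (rule measurable_compose[rotated]) measurable
      then show "(\<lambda>b. \<integral>\<^sup>+ x. indicator A (zip_upto n x (\<lambda>i. R * B (x i) b)) * (\<Prod>i<n. p (x i, R * B (x i) b))
          \<partial>PiM {..<n} (\<lambda>_. lborel)) \<in> borel_measurable \<gamma>"
        by (intro borel_measurable_nn_integral) (simp add: zip_upto_def)
    qed
    also have "\<dots> = (K * (\<integral>\<^sup>+ z. indicator A z * ennreal (ratio R n z) \<partial>Pn)) / Z"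
      by (subst linear_model) auto
    also have "\<dots> = (\<integral>\<^sup>+ z. indicator A z * ennreal (ratio R n z) \<partial>Pn) / E"
    proof -
      let ?a = "\<integral>\<^sup>+ z. indicator A z * ennreal (ratio R n z) \<partial>Pn"
      have "?a = ?a / E * E"
        using E by (simp add: ennreal_divide_times ennreal_divide_self)
      then have "K * ?a = K * (?a / E * E)" by (rule arg_cong)
      also have "\<dots> = ?a / E * Z" unfolding Z_def by (rule mult.left_commute)
      finally show ?thesis using mult_divide_eq_ennreal[OF Z, of "?a / E"] by (simp only:)
    qed
    also have "\<dots> = (\<integral>\<^sup>+ z. indicator A z * ennreal (ratio R n z) / E \<partial>Pn)"
      by (rule nn_integral_divide[symmetric]) measurable
    also have "\<dots> = emeasure (density Pn (\<lambda>z. ennreal (ratio R n z) / E)) A"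
      by (subst emeasure_density) (auto intro!: nn_integral_cong simp: divide_ennreal_def mult_ac)
    finally show "emeasure (\<nu> \<bind> iid_power n) A = emeasure (density Pn (\<lambda>z. ennreal (ratio R n z) / E)) A" .
  qed
  then show ?thesis unfolding mixtures_lin_def using \<nu> by (metis imageI)
qed

end

section \<open>The bound on the total variation distance\<close>

lemma prod_ratio_telescope:
  assumes "n + 2 \<le> d"
  shows "(\<Prod>j<n. (real d - real j - 1) / (real d - real j - 2)) = (real d - 1) / (real d - real n - 1)"
  using assms
proof (induction n)
  case (Suc n)
  then have "real d - real n - 1 > 0" "real d - real n - 2 > 0" by linarith+
  then show ?case using Suc by simp
qed simp

context gaussian_design
begin

text \<open>
  For linearly independent rows, the reciprocal of the \<open>n\<close>-dimensional volume that they span,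
  measured by \<open>B\<close>.
\<close>
definition vol_inv :: "(nat \<Rightarrow> (real^'d) \<times> real) \<Rightarrow> real" where
  "vol_inv z = (\<Prod>j<n. 1 / sqrt (B (gs (fst \<circ> z) j) (gs (fst \<circ> z) j)))"

lemma vol_inv_nonneg: "0 \<le> vol_inv z"
  unfolding vol_inv_def by (intro prod_nonneg) (simp add: form_nonneg)

lemma ratio_le_vol_inv: "ratio R n z \<le> vol_inv z"
  unfolding ratio_def vol_inv_def
  by (intro prod_mono) (auto simp: form_nonneg intro!: divide_right_mono)

lemma ratio_tendsto_vol_inv: "(\<lambda>k. ratio (real (Suc k)) n z) \<longlonglongrightarrow> vol_inv z"
  unfolding ratio_def vol_inv_def
proof (intro tendsto_prod)
  fix j
  let ?q = "B (gs (fst \<circ> z) j) (gs (fst \<circ> z) j)" and ?w = "whiten (fst \<circ> z) (snd \<circ> z) j"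
  have "(\<lambda>k. - ?w\<^sup>2 / (2 * ?q) * (inverse (real (Suc k)))\<^sup>2) \<longlonglongrightarrow> - ?w\<^sup>2 / (2 * ?q) * 0\<^sup>2"
    by (intro tendsto_intros LIMSEQ_inverse_real_of_nat)
  then have "(\<lambda>k. exp (- ?w\<^sup>2 / (2 * ?q) * (inverse (real (Suc k)))\<^sup>2) / sqrt ?q) \<longlonglongrightarrow> exp (- ?w\<^sup>2 / (2 * ?q) * 0\<^sup>2) / sqrt ?q"
    unfolding divide_inverse[of _ "sqrt ?q"] by (intro tendsto_mult_right tendsto_exp)
  moreover have "- ?w\<^sup>2 / (2 * ?q) * (inverse r)\<^sup>2 = - ?w\<^sup>2 / (2 * r\<^sup>2 * ?q)" for r
    by (simp only: divide_inverse power_inverse inverse_mult_distrib mult_ac)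
  ultimately show "(\<lambda>k. exp (- ?w\<^sup>2 / (2 * (real (Suc k))\<^sup>2 * ?q)) / sqrt ?q) \<longlonglongrightarrow> 1 / sqrt ?q"
    by simp
qed

text \<open>
  The locality hypothesis is needed because elements of the product space are functions on \<open>nat\<close>, and
  \<open>fst \<circ> z\<close> is not the default value outside the index set.
\<close>
lemma nn_integral_design:
  assumes f [measurable]: "f \<in> borel_measurable (PiM {..<n} (\<lambda>_. \<gamma>))"
    and local: "\<And>x y. (\<And>i. i < n \<Longrightarrow> x i = y i) \<Longrightarrow> f x = f y"
  shows "(\<integral>\<^sup>+ z. f (fst \<circ> z) \<partial>Pn) = (\<integral>\<^sup>+ x. f x \<partial>PiM {..<n} (\<lambda>_. \<gamma>))"
proof -
  let ?P = "density lborel p"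
  interpret P: prob_space ?P by (rule prob_P)
  interpret \<gamma>: prob_space \<gamma> by (rule prob_space_\<gamma>)
  have fst: "fst \<in> ?P \<rightarrow>\<^sub>M \<gamma>"
    using borel_measurable_continuous_onI[of fst] by (simp add: continuous_on_fst continuous_on_id cong: measurable_cong_sets)
  have "distr ?P \<gamma> fst = \<gamma>"
    unfolding marginal[symmetric] by (rule distr_cong) (auto simp: marginal)
  moreover have "distr (PiM {..<n} (\<lambda>_. ?P)) (PiM {..<n} (\<lambda>_. \<gamma>)) (compose {..<n} fst) = PiM {..<n} (\<lambda>_. distr ?P \<gamma> fst)"
    by (rule distr_PiM_finite_prob_space[OF _ _ _ fst]) (auto intro: product_prob_spaceI prob_P prob_space_\<gamma>)
  ultimately have "PiM {..<n} (\<lambda>_. \<gamma>) = distr Pn (PiM {..<n} (\<lambda>_. \<gamma>)) (compose {..<n} fst)"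
    by (simp add: iid_power_def)
  then have "(\<integral>\<^sup>+ x. f x \<partial>PiM {..<n} (\<lambda>_. \<gamma>)) = (\<integral>\<^sup>+ z. f (compose {..<n} fst z) \<partial>Pn)"
  proof (rule ssubst)
    have "compose {..<n} fst \<in> Pn \<rightarrow>\<^sub>M PiM {..<n} (\<lambda>_. \<gamma>)"
      unfolding compose_def iid_power_def
      by (intro measurable_restrict measurable_compose[OF _ fst] measurable_component_singleton)
    then show "(\<integral>\<^sup>+ x. f x \<partial>distr Pn (PiM {..<n} (\<lambda>_. \<gamma>)) (compose {..<n} fst)) = (\<integral>\<^sup>+ z. f (compose {..<n} fst z) \<partial>Pn)"
      by (rule nn_integral_distr) (use f in simp)
  qed
  also have "\<dots> = (\<integral>\<^sup>+ z. f (fst \<circ> z) \<partial>Pn)"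
    by (intro nn_integral_cong local) (simp add: compose_def)
  finally show ?thesis ..
qed

text \<open>
  For every large scale the mixture bounds the distance by its chi-square divergence. Domination by
  \<open>vol_inv\<close> controls the second moment uniformly, and dominated convergence gives the first moment as
  the scale tends to infinity.
\<close>
lemma lambda_lin_le:
  "lambda_lin n (density lborel p) \<le> 1 / 2 * sqrt (real n / (real CARD('d) - real n - 1))"
proof -
  interpret Pn: prob_space Pn by (rule prob_space_Pn)
  let ?d = "real CARD('d)"
  define m2 where "m2 = (\<Prod>j<n. 1 / (?d - real j - 2))"
  define m1 where "m1 = (\<Prod>j<n. 1 / sqrt (?d - real j - 1))"
  define e where "e k = (\<integral>z. ratio (real (Suc k)) n z \<partial>Pn)" for k
  define e_lim where "e_lim = (\<integral>z. vol_inv z \<partial>Pn)"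
  have ratio_meas [measurable]: "ratio R n \<in> borel_measurable Pn" for R
    using measurable_ratio by simp
  have vol_meas [measurable]: "vol_inv \<in> borel_measurable Pn"
    by (rule borel_measurable_LIMSEQ_real[OF ratio_tendsto_vol_inv]) simp
  have m2_pos: "0 < m2" and m1_pos: "0 < m1"
    unfolding m2_def m1_def using n_le by (auto intro!: prod_pos)
  have second: "(\<integral>\<^sup>+ z. ennreal ((vol_inv z)\<^sup>2) \<partial>Pn) \<le> ennreal m2"
  proof -
    have "(vol_inv z)\<^sup>2 = (\<Prod>j<n. 1 / B (gs (fst \<circ> z) j) (gs (fst \<circ> z) j))" for z
      by (simp add: vol_inv_def prod_power_distrib power_divide form_nonneg)
    then have "(\<integral>\<^sup>+ z. ennreal ((vol_inv z)\<^sup>2) \<partial>Pn)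
        = (\<integral>\<^sup>+ z. (\<Prod>j<n. ennreal (1 / B (gs (fst \<circ> z) j) (gs (fst \<circ> z) j))) \<partial>Pn)"
      by (simp add: prod_ennreal form_nonneg)
    also have "\<dots> = (\<integral>\<^sup>+ x. (\<Prod>j<n. ennreal (1 / B (gs x j) (gs x j))) \<partial>PiM {..<n} (\<lambda>_. \<gamma>))"
    proof (rule nn_integral_design)
      show "(\<lambda>x. \<Prod>j<n. ennreal (1 / B (gs x j) (gs x j))) \<in> borel_measurable (PiM {..<n} (\<lambda>_. \<gamma>))"
        by (intro borel_measurable_prod_ennreal) measurable
      fix x y :: "nat \<Rightarrow> real^'d" assume "\<And>i. i < n \<Longrightarrow> x i = y i"
      then have "gs x j = gs y j" if "j < n" for j using that by (intro gs_cong) auto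
      then show "(\<Prod>j<n. ennreal (1 / B (gs x j) (gs x j))) = (\<Prod>j<n. ennreal (1 / B (gs y j) (gs y j)))" by simp
    qed
    also have "\<dots> \<le> (\<Prod>j<n. ennreal (1 / (?d - real j - 2)))"
      using second_moment_inverse_volume[of n] n_le by simp
    also have "\<dots> = ennreal m2"
      unfolding m2_def using n_le by (intro prod_ennreal) auto
    finally show ?thesis .
  qed
  have first: "ennreal m1 \<le> (\<integral>\<^sup>+ z. ennreal (vol_inv z) \<partial>Pn)"
  proof -
    have "ennreal m1 = (\<Prod>j<n. ennreal (1 / sqrt (?d - real j - 1)))"
      unfolding m1_def using n_le by (intro prod_ennreal[symmetric]) auto
    also have "\<dots> \<le> (\<integral>\<^sup>+ x. (\<Prod>j<n. ennreal (1 / sqrt (B (gs x j) (gs x j)))) \<partial>PiM {..<n} (\<lambda>_. \<gamma>))"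
      using first_moment_inverse_volume[of n] n_le by simp
    also have "\<dots> = (\<integral>\<^sup>+ z. (\<Prod>j<n. ennreal (1 / sqrt (B (gs (fst \<circ> z) j) (gs (fst \<circ> z) j)))) \<partial>Pn)"
    proof (rule nn_integral_design[symmetric])
      show "(\<lambda>x. \<Prod>j<n. ennreal (1 / sqrt (B (gs x j) (gs x j)))) \<in> borel_measurable (PiM {..<n} (\<lambda>_. \<gamma>))"
        by (intro borel_measurable_prod_ennreal) measurable
      fix x y :: "nat \<Rightarrow> real^'d" assume "\<And>i. i < n \<Longrightarrow> x i = y i"
      then have "gs x j = gs y j" if "j < n" for j using that by (intro gs_cong) auto
      then show "(\<Prod>j<n. ennreal (1 / sqrt (B (gs x j) (gs x j)))) = (\<Prod>j<n. ennreal (1 / sqrt (B (gs y j) (gs y j))))" by simp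
    qed
    also have "\<dots> = (\<integral>\<^sup>+ z. ennreal (vol_inv z) \<partial>Pn)"
      by (simp add: vol_inv_def prod_ennreal form_nonneg)
    finally show ?thesis .
  qed
  have vol_sq: "integrable Pn (\<lambda>z. (vol_inv z)\<^sup>2)"
    using second by (intro integrableI_bounded) (auto simp: order_le_less_trans)
  have vol_int: "integrable Pn vol_inv"
    using Pn.square_integrable_imp_integrable[OF _ vol_sq] by simp
  have vol_sq_le: "(\<integral>z. (vol_inv z)\<^sup>2 \<partial>Pn) \<le> m2"
    using second m2_pos by (simp add: nn_integral_eq_integral[OF vol_sq])
  have "m1 \<le> e_lim"
    using first by (simp add: nn_integral_eq_integral[OF vol_int] vol_inv_nonneg e_lim_def Bochner_Integration.integral_nonneg)
  then have e_lim_pos: "0 < e_lim" using m1_pos by linarith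
  have e_tendsto: "e \<longlonglongrightarrow> e_lim"
    unfolding e_def[abs_def] e_lim_def
    by (rule integral_dominated_convergence[OF _ _ vol_int])
      (auto simp: ratio_nonneg ratio_le_vol_inv simp del: of_nat_Suc intro: ratio_tendsto_vol_inv)
  \<comment> \<open>The means \<open>e k\<close> are eventually positive, because their limit is.\<close>
  have bound: "lambda_lin n (density lborel p) \<le> 1 / 2 * sqrt (m2 / (e k)\<^sup>2 - 1)" if ek: "0 < e k" for k
  proof -
    let ?r = "ratio (real (Suc k)) n"
    let ?L = "\<lambda>z. ?r z / e k"
    have sq_le: "(?r z)\<^sup>2 \<le> (vol_inv z)\<^sup>2" for z
      using ratio_le_vol_inv ratio_nonneg by (intro power_mono)
    have r_int: "integrable Pn ?r"
      by (rule Bochner_Integration.integrable_bound[OF vol_int])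
        (auto simp: ratio_nonneg vol_inv_nonneg ratio_le_vol_inv)
    have r_sq: "integrable Pn (\<lambda>z. (?r z)\<^sup>2)"
      by (rule Bochner_Integration.integrable_bound[OF vol_sq]) (use sq_le in auto)
    have r_sq_le: "(\<integral>z. (?r z)\<^sup>2 \<partial>Pn) \<le> m2"
      using integral_mono[OF r_sq vol_sq sq_le] vol_sq_le by simp
    have E: "(\<integral>\<^sup>+ z. ennreal (?r z) \<partial>Pn) = ennreal (e k)"
      unfolding e_def by (rule nn_integral_eq_integral[OF r_int]) (simp add: ratio_nonneg)
    have "density Pn (\<lambda>z. ennreal (?r z) / ennreal (e k)) \<in> mixtures_lin n"
      using ek by (intro density_ratio_in_mixtures) (auto simp: E simp del: of_nat_Suc)
    then have mix: "density Pn (\<lambda>z. ennreal (?L z)) \<in> mixtures_lin n"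
      using ek by (simp add: divide_ennreal ratio_nonneg)
    have "bdd_below (tv_dist Pn ` mixtures_lin n)"
    proof (rule bdd_belowI2)
      fix Q :: "(nat \<Rightarrow> (real^'d) \<times> real) measure" assume "Q \<in> mixtures_lin n"
      then interpret Q: prob_space Q
        unfolding mixtures_lin_def
        by (auto intro!: prob_space_bind' measurable_restrict_space1 measurable_iid_power)
      have "bdd_above ((\<lambda>A. \<bar>measure Pn A - measure Q A\<bar>) ` sets Pn)"
      proof (rule bdd_aboveI2)
        show "\<bar>measure Pn A - measure Q A\<bar> \<le> 1" for A
          using Pn.prob_le_1[of A] Q.prob_le_1[of A] measure_nonneg[of Pn A] measure_nonneg[of Q A] by linarith
      qed
      then show "0 \<le> tv_dist Pn Q"
        unfolding tv_dist_def by (rule cSUP_upper2[where x="{}"]) auto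
    qed
    then have "lambda_lin n (density lborel p) \<le> tv_dist Pn (density Pn (\<lambda>z. ennreal (?L z)))"
      unfolding lambda_lin_def by (rule cINF_lower[OF _ mix])
    also have "\<dots> \<le> 1 / 2 * sqrt ((\<integral>z. (?L z)\<^sup>2 \<partial>Pn) - 1)"
      using r_sq ek by (intro tv_dist_density_le prob_space_Pn) (auto simp: power_divide ratio_nonneg e_def[symmetric] simp del: of_nat_Suc)
    also have "\<dots> \<le> 1 / 2 * sqrt (m2 / (e k)\<^sup>2 - 1)"
      using r_sq_le by (simp add: power_divide divide_right_mono)
    finally show ?thesis .
  qed
  have "(\<lambda>k. 1 / 2 * sqrt (m2 / (e k)\<^sup>2 - 1)) \<longlonglongrightarrow> 1 / 2 * sqrt (m2 / e_lim\<^sup>2 - 1)"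
    using e_lim_pos by (intro tendsto_intros e_tendsto) auto
  moreover have "eventually (\<lambda>k. lambda_lin n (density lborel p) \<le> 1 / 2 * sqrt (m2 / (e k)\<^sup>2 - 1)) sequentially"
    using order_tendstoD(1)[OF e_tendsto e_lim_pos] by eventually_elim (rule bound)
  ultimately have "lambda_lin n (density lborel p) \<le> 1 / 2 * sqrt (m2 / e_lim\<^sup>2 - 1)"
    by (rule tendsto_lowerbound) simp
  also have "\<dots> \<le> 1 / 2 * sqrt (m2 / m1\<^sup>2 - 1)"
    using \<open>m1 \<le> e_lim\<close> m1_pos m2_pos by (simp add: divide_left_mono power_mono)
  also have "m2 / m1\<^sup>2 - 1 = real n / (?d - real n - 1)"
  proof -
    have "m2 / m1\<^sup>2 = (\<Prod>j<n. (1 / (?d - real j - 2)) / (1 / sqrt (?d - real j - 1))\<^sup>2)"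
      unfolding m2_def m1_def prod_power_distrib prod_dividef[symmetric] by (rule refl)
    also have "\<dots> = (\<Prod>j<n. (?d - real j - 1) / (?d - real j - 2))"
      using n_le by (intro prod.cong refl) (auto simp: power_divide)
    also have "\<dots> = (?d - 1) / (?d - real n - 1)"
      by (rule prod_ratio_telescope[OF n_le])
    finally show ?thesis using n_le by (simp add: field_simps)
  qed
  finally show ?thesis .
qed

end

section \<open>From covariance matrices to quadratic forms\<close>

lemma positive_definite_invertible:
  fixes S :: "real^'d^'d"
  assumes "positive_definite S"
  shows "invertible S"
proof -
  have "x = 0" if "S *v x = 0" for x
    using assms that by (auto simp: positive_definite_def dest!: spec[of _ x])
  then show ?thesis
    using matrix_left_invertible_ker[of S] by (auto simp: invertible_left_inverse)
qed

lemma mult_matrix_inv_vector: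
  fixes S :: "real^'d^'d"
  assumes "invertible S"
  shows "S *v (matrix_inv S *v x) = x"
  using assms someI_ex[of "\<lambda>A'. S ** A' = mat 1 \<and> A' ** S = mat 1"]
  by (simp add: matrix_vector_mul_assoc invertible_def matrix_inv_def)

text \<open>
  Substitute \<open>x = S x'\<close> and \<open>y = S y'\<close>: the properties of the inverse matrix reduce to those of \<open>S\<close>.
\<close>
lemma matrix_inv_form_sym:
  fixes S :: "real^'d^'d"
  assumes "positive_definite S"
  shows "x \<bullet> (matrix_inv S *v y) = y \<bullet> (matrix_inv S *v x)"
proof -
  let ?x = "matrix_inv S *v x" and ?y = "matrix_inv S *v y"
  have S: "transpose S = S" using assms by (simp add: positive_definite_def)
  note inv = mult_matrix_inv_vector[OF positive_definite_invertible[OF assms]]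
  have "x \<bullet> ?y = (S *v ?x) \<bullet> ?y" by (simp add: inv)
  also have "\<dots> = ?x \<bullet> (S *v ?y)"
    by (metis S dot_lmul_matrix transpose_matrix_vector)
  also have "\<dots> = y \<bullet> ?x" by (simp add: inv inner_commute)
  finally show ?thesis .
qed

lemma matrix_inv_form_pos:
  fixes S :: "real^'d^'d"
  assumes "positive_definite S" and "x \<noteq> 0"
  shows "0 < x \<bullet> (matrix_inv S *v x)"
proof -
  let ?x = "matrix_inv S *v x"
  note inv = mult_matrix_inv_vector[OF positive_definite_invertible[OF assms(1)]]
  have "?x \<noteq> 0" using inv[of x] assms(2) by (metis matrix_vector_mult_0_right)
  then have "0 < ?x \<bullet> (S *v ?x)" using assms(1) by (simp add: positive_definite_def)
  then show ?thesis by (simp add: inv inner_commute)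
qed

theorem corollary9:
  fixes P :: "((real^'d) \<times> real) measure"
    and \<Sigma> :: "real^'d^'d"
    and n :: nat
  assumes "prob_space P"
    and "\<exists>p \<in> borel_measurable lborel. P = density lborel p"
    and "positive_definite \<Sigma>"
    and "distr P borel fst = multivariate_normal 0 \<Sigma>"
    and "n \<ge> 1"
    and "CARD('d) \<ge> n + 2"
  shows "lambda_lin n P \<le> 1 / 2 * sqrt (real n / (real CARD('d) - real n - 1))"
proof -
  from assms(2) obtain p where p: "p \<in> borel_measurable lborel" "P = density lborel p" by blast
  define B where "B x y = x \<bullet> (matrix_inv \<Sigma> *v y)" for x y :: "real^'d"
  define \<kappa> where "\<kappa> = 1 / sqrt ((2 * pi) ^ CARD('d) * det \<Sigma>)"
  have normal: "multivariate_normal 0 \<Sigma> = density lborel (\<lambda>x. ennreal (\<kappa> * exp (- B x x / 2)))"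
    by (simp add: multivariate_normal_def B_def \<kappa>_def)
  \<comment> \<open>The form is the inverse covariance, so that the given marginal is the Gaussian law of the form.\<close>
  have "bilinear B"
    by (auto simp: bilinear_def linear_iff B_def inner_add_left inner_add_right matrix_vector_right_distrib
        matrix_vector_mult_scaleR)
  then interpret bounded_bilinear B by (simp add: bilinear_conv_bounded_bilinear)
  have [measurable]: "(\<lambda>x. B x x) \<in> borel_measurable borel"
    by (intro borel_measurable_continuous_onI continuous_on continuous_on_id)
  interpret P: prob_space P by fact
  interpret X: prob_space "multivariate_normal 0 \<Sigma>"
    unfolding assms(4)[symmetric]
    using borel_measurable_continuous_onI[of fst] p
    by (intro P.prob_space_distr) (simp add: continuous_on_fst continuous_on_id cong: measurable_cong_sets)
  have total: "(\<integral>\<^sup>+ x. ennreal (\<kappa> * exp (- B x x / 2)) \<partial>lborel) = 1"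
    using X.emeasure_space_1 unfolding normal by (simp add: emeasure_density)
  have \<kappa>: "0 < \<kappa>"
  proof (rule ccontr)
    \<comment> \<open>A nonpositive constant would make the normal density vanish, against total mass one.\<close>
    assume "\<not> 0 < \<kappa>"
    then have "ennreal (\<kappa> * exp (- B x x / 2)) = 0" for x
      by (intro ennreal_neg mult_nonpos_nonneg) auto
    then show False using total by simp
  qed
  have sym: "B x y = B y x" and pos: "x \<noteq> 0 \<Longrightarrow> 0 < B x x" for x y
    unfolding B_def by (rule matrix_inv_form_sym[OF assms(3)], rule matrix_inv_form_pos[OF assms(3)])
  interpret gaussian_form B \<kappa>
    by unfold_locales (fact sym pos \<kappa> total)+
  interpret gaussian_design B \<kappa> p n
  proof (intro gaussian_design.intro gaussian_design_axioms.intro)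
    show "gaussian_form B \<kappa>" ..
    show "p \<in> borel_measurable borel" using p(1) by simp
    show "prob_space (density lborel p)" using assms(1) unfolding p(2) .
    show "distr (density lborel p) borel fst = \<gamma>" using assms(4) unfolding p(2) normal \<gamma>_def .
  qed (fact assms)+
  show ?thesis using lambda_lin_le unfolding p(2) .
qed

end
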